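(* Let $\boldsymbol{x}=(\boldsymbol{x}_1,\ldots,\boldsymbol{x}_\ell)$ and $\boldsymbol{y}=(\boldsymbol{y}_1,\ldots,\boldsymbol{y}_\ell)$ be time series in $\mathbb{R}^d$ of common length $\ell\ge 2$, with signature kernel $K:[0,1]^2\to\mathbb{R}$, and let $\kappa_{k,l}=K|_{T_{k,l}}$. For each $k,l\in\{1,\ldots,\ell-1\}$ there is $C^{k,l}\equiv(c^{i,j}_{k,l})_{i,j\ge0}\in\ell_1(\mathbb{N}_0^2)$ such that $$\kappa_{k,l}=C^{k,l}_{\langle\sigma,\tau\rangle}\big|_{T_{k,l}}\qquad\text{and}\qquad C^{k,l}=\sum_{n=0}^\infty C^{k,l}_n\quad\text{in }\ell_1(\mathbb{N}_0^2),$$ with $\kappa_{k,l}=\lim_{m\to\infty}\big[\sum_{n=0}^m C^{k,l}_n\big]_{\langle\sigma,\tau\rangle}$ uniformly on $T_{k,l}$. Here the sequence $(C^{k,l}_n)_{n\ge0}\subset\ell_1(\mathbb{N}_0^2)$ is defined recursively by $$C^{k,l}_{n+1}=\rho_{k,l}\,L_{\sigma_k}\,C^{k,l}_n\,R_{\tau_l}\qquad(n\in\mathbb{N}_0)$$ with initial value $$C^{k,l}_0:=\big(\alpha_i\,\delta_{0j}+\beta_j\,\delta_{i0}-\gamma\,\delta_{0i}\delta_{0j}\big)_{i,j\ge0},$$ where $(\alpha_i)_{i\ge0}:=C^{k,l-1}\eta(\tau_l)\in\ell_1(\mathbb{N}_0)$, $(\beta_i)_{i\ge0}:=(C^{k-1,l})^{\dagger}\eta(\sigma_k)\in\ell_1(\mathbb{N}_0)$,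 $\gamma:=\langle\eta(\sigma_k),C^{k-1,l}\eta(\tau_l)\rangle$, and the boundary coefficients are $C^{0,\iota}=C^{\iota,0}:=(\delta_{0i}\delta_{0j})_{i,j\ge0}$ for each $\iota\in\mathbb{N}_0$. The matrices $L_\sigma,R_\tau$ are $$L_\sigma:=(I-H(\sigma))\,\underline{S},\qquad R_\tau:=\underline{T}\,(I-G(\tau)),$$ with $I:=(\delta_{ij})_{i,j\ge0}$, $H(\sigma):=(\sigma^j\delta_{i0})_{i,j\ge0}$, $G(\tau):=(\tau^i\delta_{0j})_{i,j\ge0}$, $\underline{S}:=\big(\tfrac{\delta_{i-1,j}}{i}\big)_{i,j\ge0}$, $\underline{T}:=\big(\tfrac{\delta_{i,j-1}}{j}\big)_{i,j\ge0}$, where $\tfrac00:=0$.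
   Context: Grid and tiles: $\sigma_k:=\frac{k-1}{\ell-1}$, $\tau_l:=\frac{l-1}{\ell-1}$ for $k,l=1,\ldots,\ell$. For $k,l\in\{1,\ldots,\ell-1\}$: $\mathcal{D}_{k,l}:=(\sigma_k,\sigma_{k+1})\times(\tau_l,\tau_{l+1})$, $T_{k,l}:=[\sigma_k,\sigma_{k+1}]\times[\tau_l,\tau_{l+1}]$, and $\mathcal{D}:=\bigcup_{k,l=1}^{\ell-1}\mathcal{D}_{k,l}$. Coefficients: with $\Delta_k\boldsymbol{z}:=\boldsymbol{z}_{k+1}-\boldsymbol{z}_k$ and $\langle\cdot,\cdot\rangle$ the Euclidean inner product on $\mathbb{R}^d$, set $\rho_{k,l}:=(\ell-1)^2\langle\Delta_k\boldsymbol{x},\Delta_l\boldsymbol{y}\rangle$ for $k,l\in\{1,\ldots,\ell-1\}$. Define $\rho_{\boldsymbol{x},\boldsymbol{y}}(s,t):=\rho_{k,l}$ for $(s,t)\in\mathcal{D}_{k,l}$ and $\rho_{\boldsymbol{x},\boldsymbol{y}}:=0$ on $[0,1]^2\setminus\mathcal{D}$. (On $\mathcal{D}_{k,l}$ this equals $\langle\hat{\boldsymbol{x}}'(s),\hat{\boldsymbol{y}}'(t)\rangle$, where $\hat{\boldsymbol{x}},\hat{\boldsymbol{y}}:[0,1]\to\mathbb{R}^d$ are the continuous piecewise linear interpolants of $\boldsymbol{x},\boldsymbol{y}$ on the uniform grid.) Signature kernel: the signature kernel of $\boldsymbol{x}$ and $\boldsymbol{y}$ is the unique continuous function $K:[0,1]^2\to\mathbb{R}$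 solving $\frac{\partial^2K}{\partial s\,\partial t}(s,t)=\rho_{\boldsymbol{x},\boldsymbol{y}}(s,t)K(s,t)$ for $(s,t)\in\mathcal{D}$ with $K(0,\cdot)=K(\cdot,0)=1$; equivalently, the unique continuous solution of $K(s,t)=1+\int_0^t\int_0^s\rho_{\boldsymbol{x},\boldsymbol{y}}(u,v)K(u,v)\,\mathrm{d}u\,\mathrm{d}v$ on $[0,1]^2$. Matrix notation: $\mathbb{N}_0=\{0,1,2,\ldots\}$; $\delta_{ij}$ is the Kronecker delta. The power map $\eta:[0,1]\to\ell_\infty(\mathbb{N}_0)$ is $\eta(r)=(r^i)_{i\ge0}=(1,r,r^2,\ldots)$ (with $0^0=1$). An element $C=(c_{ij})_{i,j\ge0}\in\ell_1(\mathbb{N}_0^2)$ (absolutely summable) is regarded as a doubly-infinite matrix acting $\ell_\infty(\mathbb{N}_0)\to\ell_1(\mathbb{N}_0)$ by $C\cdot a:=\big(\sum_{j\ge0}c_{ij}a_j\big)_{i\ge0}$; $C^\dagger$ denotes its transpose; products of doubly-infinite matrices are the usual matrix products. $\langle\cdot,\cdot\rangle$ between sequences is the dual pairing $\langle a,b\rangle=\sum_{i\ge0}a_ib_i$ of $\ell_\infty(\mathbb{N}_0)$ and $\ell_1(\mathbb{N}_0)$. Each such $C$ induces the continuous function $C_{\langle\sigma,\tau\rangle}:[0,1]^2\to\mathbb{R}$, $C_{\langle\sigma,\tau\rangle}(s,t):=\langle\eta(s),C\eta(t)\rangle=\sum_{i,j\ge0}c_{ij}s^it^j$; also written $[C]_{\langle\sigma,\tau\rangle}$.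 *)

theory Defs
  imports "HOL-Analysis.Analysis"
begin

text \<open>
  A time series of length \<open>N\<close> in \<open>\<real>\<^sup>d\<close> is a function \<open>x :: nat \<Rightarrow> real ^ 'd\<close> of which only
  the values \<open>x 1, \<dots>, x N\<close> are used.
\<close>

section \<open>Grid, tiles and coefficients\<close>

text \<open>Both families of grid points \<open>\<sigma>\<^sub>k\<close> and \<open>\<tau>\<^sub>l\<close> are given by the same formula.\<close>

definition grid :: "nat \<Rightarrow> nat \<Rightarrow> real" where
  "grid N k = (real k - 1) / (real N - 1)"

definition open_tile :: "nat \<Rightarrow> nat \<Rightarrow> nat \<Rightarrow> (real \<times> real) set" where
  "open_tile N k l = {grid N k<..<grid N (k + 1)} \<times> {grid N l<..<grid N (l + 1)}"

definition tile :: "nat \<Rightarrow> nat \<Rightarrow> nat \<Rightarrow> (real \<times> real) set" where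
  "tile N k l = {grid N k..grid N (k + 1)} \<times> {grid N l..grid N (l + 1)}"

definition tile_interior :: "nat \<Rightarrow> (real \<times> real) set" where
  "tile_interior N = (\<Union>k\<in>{1..N - 1}. \<Union>l\<in>{1..N - 1}. open_tile N k l)"

definition rho :: "nat \<Rightarrow> (nat \<Rightarrow> real ^ 'd) \<Rightarrow> (nat \<Rightarrow> real ^ 'd) \<Rightarrow> nat \<Rightarrow> nat \<Rightarrow> real" where
  "rho N x y k l = (real N - 1)\<^sup>2 * ((x (k + 1) - x k) \<bullet> (y (l + 1) - y l))"

text \<open>
  The open tiles are pairwise disjoint, so at most one summand is nonzero: \<open>rho_fun N x y\<close> is
  \<open>rho N x y k l\<close> on \<open>open_tile N k l\<close> and \<open>0\<close> off \<open>tile_interior N\<close>.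
\<close>

definition rho_fun ::
  "nat \<Rightarrow> (nat \<Rightarrow> real ^ 'd) \<Rightarrow> (nat \<Rightarrow> real ^ 'd) \<Rightarrow> real \<times> real \<Rightarrow> real" where
  "rho_fun N x y p =
     (\<Sum>k=1..N - 1. \<Sum>l=1..N - 1. rho N x y k l * indicator (open_tile N k l) p)"


section \<open>The signature kernel\<close>

text \<open>
  \<open>K\<close> is a continuous solution on \<open>[0,1]\<^sup>2\<close> of the Goursat problem with unit boundary data. The mixed
  derivative \<open>\<partial>\<^sup>2K/\<partial>s\<partial>t = \<partial>/\<partial>s (\<partial>K/\<partial>t)\<close> is the classical pointwise one, required to exist on the
  union of the open tiles. The values of \<open>K\<close> outside \<open>[0,1]\<^sup>2\<close> are irrelevant.
\<close>

definition is_signature_kernel ::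
  "nat \<Rightarrow> (nat \<Rightarrow> real ^ 'd) \<Rightarrow> (nat \<Rightarrow> real ^ 'd) \<Rightarrow> (real \<times> real \<Rightarrow> real) \<Rightarrow> bool" where
  "is_signature_kernel N x y K \<longleftrightarrow>
     continuous_on ({0..1} \<times> {0..1}) K \<and>
     (\<forall>t\<in>{0..1}. K (0, t) = 1) \<and>
     (\<forall>s\<in>{0..1}. K (s, 0) = 1) \<and>
     (\<forall>(s, t)\<in>tile_interior N.
        (\<lambda>t'. K (s, t')) differentiable (at t) \<and>
        ((\<lambda>s'. deriv (\<lambda>t'. K (s', t')) t) has_real_derivative
           rho_fun N x y (s, t) * K (s, t)) (at s))"


section \<open>Sequences and doubly-infinite matrices\<close>

type_synonym infmat = "nat \<Rightarrow> nat \<Rightarrow> real"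

definition ell1_seq :: "(nat \<Rightarrow> real) \<Rightarrow> bool" where
  "ell1_seq a \<longleftrightarrow> (\<lambda>i. \<bar>a i\<bar>) summable_on UNIV"

definition ell1_mat :: "infmat \<Rightarrow> bool" where
  "ell1_mat C \<longleftrightarrow> (\<lambda>(i, j). \<bar>C i j\<bar>) summable_on UNIV"

definition ell1_norm :: "infmat \<Rightarrow> real" where
  "ell1_norm C = (\<Sum>\<^sub>\<infinity>(i, j)\<in>UNIV. \<bar>C i j\<bar>)"

definition eta :: "real \<Rightarrow> nat \<Rightarrow> real" where
  "eta r i = r ^ i"

definition inf_mult :: "infmat \<Rightarrow> infmat \<Rightarrow> infmat" where
  "inf_mult A B = (\<lambda>i j. \<Sum>\<^sub>\<infinity>m. A i m * B m j)"

definition inf_mult_vec :: "infmat \<Rightarrow> (nat \<Rightarrow> real) \<Rightarrow> nat \<Rightarrow> real" where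
  "inf_mult_vec C a = (\<lambda>i. \<Sum>\<^sub>\<infinity>j. C i j * a j)"

definition inf_transpose :: "infmat \<Rightarrow> infmat" where
  "inf_transpose C = (\<lambda>i j. C j i)"

definition pairing :: "(nat \<Rightarrow> real) \<Rightarrow> (nat \<Rightarrow> real) \<Rightarrow> real" where
  "pairing a b = (\<Sum>\<^sub>\<infinity>i. a i * b i)"

definition induced_fun :: "infmat \<Rightarrow> real \<times> real \<Rightarrow> real" where
  "induced_fun C = (\<lambda>(s, t). pairing (eta s) (inf_mult_vec C (eta t)))"

definition kron :: "nat \<Rightarrow> nat \<Rightarrow> real" where
  "kron i j = (if i = j then 1 else 0)"

definition mat_I :: infmat where
  "mat_I = (\<lambda>i j. kron i j)"

definition mat_H :: "real \<Rightarrow> infmat" where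
  "mat_H \<sigma> = (\<lambda>i j. \<sigma> ^ j * kron i 0)"

definition mat_G :: "real \<Rightarrow> infmat" where
  "mat_G \<tau> = (\<lambda>i j. \<tau> ^ i * kron 0 j)"

text \<open>
  \<open>\<delta>\<^bsub>i-1,j\<^esub>\<close> is written as \<open>\<delta>\<^bsub>i,j+1\<^esub>\<close>, avoiding truncated subtraction; hence row \<open>0\<close> of
  \<open>mat_S\<close> and column \<open>0\<close> of \<open>mat_T\<close> vanish, in accordance with \<open>0/0 = 0\<close>.
\<close>

definition mat_S :: infmat where
  "mat_S = (\<lambda>i j. kron i (j + 1) / real i)"

definition mat_T :: infmat where
  "mat_T = (\<lambda>i j. kron (i + 1) j / real j)"

definition mat_L :: "real \<Rightarrow> infmat" where
  "mat_L \<sigma> = inf_mult (\<lambda>i j. mat_I i j - mat_H \<sigma> i j) mat_S"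

definition mat_R :: "real \<Rightarrow> infmat" where
  "mat_R \<tau> = inf_mult mat_T (\<lambda>i j. mat_I i j - mat_G \<tau> i j)"


section \<open>The recursion on a tile\<close>

text \<open>
  Here \<open>C k l\<close> is the coefficient matrix of tile \<open>(k, l)\<close>. For given \<open>k, l \<ge> 1\<close> the definitions below
  depend on the family \<open>C\<close> only through the neighbours \<open>C k (l - 1)\<close> and \<open>C (k - 1) l\<close>.
\<close>

definition tile_alpha :: "nat \<Rightarrow> (nat \<Rightarrow> nat \<Rightarrow> infmat) \<Rightarrow> nat \<Rightarrow> nat \<Rightarrow> nat \<Rightarrow> real" where
  "tile_alpha N C k l = inf_mult_vec (C k (l - 1)) (eta (grid N l))"

definition tile_beta :: "nat \<Rightarrow> (nat \<Rightarrow> nat \<Rightarrow> infmat) \<Rightarrow> nat \<Rightarrow> nat \<Rightarrow> nat \<Rightarrow> real" where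
  "tile_beta N C k l = inf_mult_vec (inf_transpose (C (k - 1) l)) (eta (grid N k))"

definition tile_gamma :: "nat \<Rightarrow> (nat \<Rightarrow> nat \<Rightarrow> infmat) \<Rightarrow> nat \<Rightarrow> nat \<Rightarrow> real" where
  "tile_gamma N C k l =
     pairing (eta (grid N k)) (inf_mult_vec (C (k - 1) l) (eta (grid N l)))"

primrec tile_term ::
  "nat \<Rightarrow> (nat \<Rightarrow> real ^ 'd) \<Rightarrow> (nat \<Rightarrow> real ^ 'd) \<Rightarrow> (nat \<Rightarrow> nat \<Rightarrow> infmat) \<Rightarrow> nat \<Rightarrow> nat \<Rightarrow> nat \<Rightarrow> infmat"
where
  "tile_term N x y C k l 0 =
     (\<lambda>i j. tile_alpha N C k l i * kron 0 j + tile_beta N C k l j * kron i 0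
            - tile_gamma N C k l * kron 0 i * kron 0 j)"
| "tile_term N x y C k l (Suc n) =
     (\<lambda>i j. rho N x y k l *
        inf_mult (inf_mult (mat_L (grid N k)) (tile_term N x y C k l n)) (mat_R (grid N l)) i j)"

end

theory Submission
  imports Defs
begin

text \<open>
  On one tile, with lower left corner \<open>(\<sigma>, \<tau>)\<close> and constant coefficient \<open>\<rho>\<close>, the kernel solves a
  Goursat problem: \<open>\<partial>\<^sub>s\<partial>\<^sub>t K = \<rho> K\<close> with data on the left and bottom edges inherited from the
  neighbouring tiles. Integrating from the corner gives
  \<open>K(s, t) = K(s, \<tau>) + K(\<sigma>, t) - K(\<sigma>, \<tau>) + \<rho> \<integral>\<integral> K\<close>, and the recursion for the matrices \<open>C\<^sub>n\<close> is
  Picard iteration of this equation, written in power series coefficients.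

  The iteration is transparent because everything factorises. If \<open>V\<^sub>\<sigma>\<close> denotes the Volterra operator
  \<open>f \<mapsto> \<integral>\<^sub>\<sigma>\<^sup>s f\<close> acting on coefficient sequences, then multiplication by \<open>L\<^sub>\<sigma>\<close> from the left is
  \<open>V\<^sub>\<sigma>\<close> applied to every column, and multiplication by \<open>R\<^sub>\<tau>\<close> from the right is \<open>V\<^sub>\<tau>\<close> applied to
  every row (\<open>inf_mult_mat_L\<close>, \<open>inf_mult_mat_R\<close>). The initial matrix is a sum of three outer products,
  each of which has the unit sequence \<open>e\<close> (the constant function 1) as a factor. Hence
  \<open>C\<^sub>n = \<rho>\<^sup>n (V\<^sub>\<sigma>\<^sup>n \<alpha> \<otimes> V\<^sub>\<tau>\<^sup>n e + V\<^sub>\<sigma>\<^sup>n e \<otimes> V\<^sub>\<tau>\<^sup>n \<beta> - \<gamma> V\<^sub>\<sigma>\<^sup>n e \<otimes> V\<^sub>\<tau>\<^sup>n e)\<close>.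
  The sequence \<open>V\<^sub>\<sigma>\<^sup>n e\<close> consists of the coefficients of \<open>(s - \<sigma>)\<^sup>n / n!\<close> and therefore has norm at most
  \<open>2\<^sup>n / n!\<close>, whereas \<open>V\<^sub>\<sigma>\<close> itself has norm at most 2. So the norms of \<open>C\<^sub>n\<close> are bounded by a constant
  times \<open>(4 |\<rho>|)\<^sup>n / n!\<close>, and the series converges in \<open>\<ell>\<^sub>1\<close>; its sum is the matrix of the tile.

  It remains to see that the sum represents the given \<open>K\<close>. The difference \<open>u\<^sub>m\<close> of \<open>K\<close> and the first
  \<open>m\<close> Picard terms satisfies \<open>u\<^sub>0 = K\<close> and \<open>\<partial>\<^sub>s\<partial>\<^sub>t u\<^bsub>m+1\<^esub> = \<rho> u\<^sub>m\<close>, and \<open>u\<^bsub>m+1\<^esub>\<close> vanishes on the left and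
  bottom edges. Iterating a mean value estimate for the mixed derivative (\<open>goursat_bound\<close>)
  yields \<open>|u\<^sub>m| \<le> B |\<rho>|\<^sup>m (s - \<sigma>)\<^sup>m (t - \<tau>)\<^sup>m / m!\<^sup>2\<close>, so the Picard terms sum to \<open>K\<close>
  (\<open>goursat_picard_limit\<close>). Induction over the tiles then carries the edge data from one tile to the next.
\<close>

section \<open>Absolutely summable sequences\<close>

definition seq_norm :: "(nat \<Rightarrow> real) \<Rightarrow> real" where
  "seq_norm a = (\<Sum>\<^sub>\<infinity>i. \<bar>a i\<bar>)"

lemma abs_summable_nat:
  fixes f :: "nat \<Rightarrow> real"
  assumes "(\<lambda>i. \<bar>f i\<bar>) summable_on UNIV"
  shows "f summable_on UNIV" "f sums infsum f UNIV"
proof -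
  show *: "f summable_on UNIV"
    using assms by - (rule abs_summable_summable, simp add: real_norm_def)
  show "f sums infsum f UNIV"
    using * by (simp add: has_sum_imp_sums)
qed

lemma infsum_singleton_support:
  fixes f :: "'a \<Rightarrow> real"
  assumes "\<And>i. i \<noteq> k \<Longrightarrow> f i = 0"
  shows "infsum f UNIV = f k"
proof -
  have "infsum f UNIV = infsum f {k}"
    by (rule infsum_cong_neutral) (use assms in auto)
  then show ?thesis by simp
qed

lemma ell1_seq_dominated:
  assumes "ell1_seq b" "\<And>i. \<bar>a i\<bar> \<le> \<bar>b i\<bar>"
  shows "ell1_seq a"
  using assms unfolding ell1_seq_def
  by - (rule summable_on_comparison_test[where f = "\<lambda>i. \<bar>b i\<bar>"], auto)

lemma ell1_seq_scale:
  assumes "ell1_seq a"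
  shows "ell1_seq (\<lambda>i. c * a i)"
  using summable_on_cmult_right[OF assms[unfolded ell1_seq_def], of "\<bar>c\<bar>"]
  by (simp add: ell1_seq_def abs_mult)

lemma ell1_seq_weighted:
  assumes "ell1_seq a" "\<And>i. \<bar>w i\<bar> \<le> 1"
  shows "ell1_seq (\<lambda>i. w i * a i)"
  by (rule ell1_seq_dominated[OF assms(1)])
     (use assms(2) in \<open>auto simp: abs_mult intro: mult_left_le_one_le\<close>)

lemma ell1_seq_summable:
  assumes "ell1_seq a" "\<And>i. \<bar>w i\<bar> \<le> 1"
  shows "(\<lambda>i. w i * a i) summable_on UNIV"
  using ell1_seq_weighted[OF assms] unfolding ell1_seq_def by (rule abs_summable_nat)

lemma abs_infsum_weighted_le:
  assumes "ell1_seq a" "\<And>i. \<bar>w i\<bar> \<le> 1"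
  shows "\<bar>\<Sum>\<^sub>\<infinity>i. w i * a i\<bar> \<le> seq_norm a"
  unfolding seq_norm_def real_norm_def[symmetric]
proof (rule norm_infsum_le[OF has_sum_infsum has_sum_infsum])
  show "(\<lambda>i. norm (a i)) summable_on UNIV"
    using assms(1) by (simp add: ell1_seq_def)
  show "norm (w i * a i) \<le> norm (a i)" for i
    using assms(2) by (auto simp: abs_mult intro: mult_left_le_one_le)
qed (rule ell1_seq_summable[OF assms])

lemma eta_le_1: "s \<in> {0..1} \<Longrightarrow> \<bar>eta s i\<bar> \<le> 1"
  by (simp add: eta_def power_le_one)

lemma ell1_seq_kron: "ell1_seq (kron 0)"
proof -
  have "((\<lambda>i. \<bar>kron 0 i\<bar>) has_sum \<bar>kron 0 0\<bar>) UNIV"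
    by (rule has_sum_finite_neutralI[where B = "{0}"]) (auto simp: kron_def)
  then show ?thesis unfolding ell1_seq_def by (rule has_sum_imp_summable)
qed

lemma pairing_kron: "pairing a (kron 0) = a 0"
  unfolding pairing_def by (subst infsum_singleton_support[where k = 0]) (auto simp: kron_def)

section \<open>The Volterra operator on coefficients\<close>

text \<open>
  If \<open>a\<close> holds the coefficients of a power series \<open>f\<close>, then \<open>volterra \<sigma> a\<close> holds those of the
  antiderivative of \<open>f\<close> that vanishes at \<open>\<sigma>\<close>: the higher coefficients come from termwise integration,
  and the zeroth one is the constant of integration.
\<close>

definition volterra :: "real \<Rightarrow> (nat \<Rightarrow> real) \<Rightarrow> nat \<Rightarrow> real" where
  "volterra \<sigma> a i =
     (case i of 0 \<Rightarrow> - (\<Sum>\<^sub>\<infinity>m. \<sigma> ^ Suc m / real (Suc m) * a m) | Suc m \<Rightarrow> a m / real (Suc m))"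

lemma volterra_0: "volterra \<sigma> a 0 = - (\<Sum>\<^sub>\<infinity>m. \<sigma> ^ Suc m / real (Suc m) * a m)"
  by (simp add: volterra_def)

lemma volterra_Suc: "volterra \<sigma> a (Suc m) = a m / real (Suc m)"
  by (simp add: volterra_def)

lemma volterra_weight:
  assumes "\<sigma> \<in> {0..1}"
  shows "\<bar>\<sigma> ^ Suc m / real (Suc m)\<bar> \<le> 1"
proof -
  have "\<sigma> ^ Suc m \<le> 1" using assms by (intro power_le_one) auto
  then show ?thesis using assms by (simp add: field_simps del: power_Suc)
qed

text \<open>
  The factor 2 is one copy of the norm of \<open>a\<close> for the shifted coefficients \<open>a m / (m + 1)\<close> and one for the
  constant of integration, whose weights \<open>\<sigma>\<^bsup>m+1\<^esup> / (m + 1)\<close> are at most 1.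
\<close>

lemma
  assumes "ell1_seq a" "\<sigma> \<in> {0..1}"
  shows ell1_seq_volterra: "ell1_seq (volterra \<sigma> a)"
    and seq_norm_volterra: "seq_norm (volterra \<sigma> a) \<le> 2 * seq_norm a"
proof -
  have a: "summable (\<lambda>i. \<bar>a i\<bar>)"
    using assms(1) summable_on_UNIV_nonneg_real_iff[of "\<lambda>i. \<bar>a i\<bar>"] by (simp add: ell1_seq_def)
  have le: "\<bar>volterra \<sigma> a (Suc i)\<bar> \<le> \<bar>a i\<bar>" for i
    by (simp add: volterra_def field_simps mult_nonneg_nonneg)
  have s: "summable (\<lambda>i. \<bar>volterra \<sigma> a (Suc i)\<bar>)"
    by (rule summable_comparison_test'[OF a, of 0]) (use le in auto)
  then have s': "summable (\<lambda>i. \<bar>volterra \<sigma> a i\<bar>)"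
    by (subst (asm) summable_Suc_iff)
  then show "ell1_seq (volterra \<sigma> a)"
    using summable_on_UNIV_nonneg_real_iff[of "\<lambda>i. \<bar>volterra \<sigma> a i\<bar>"] by (simp add: ell1_seq_def)
  have eq: "seq_norm b = (\<Sum>i. \<bar>b i\<bar>)" if "summable (\<lambda>i. \<bar>b i\<bar>)" for b :: "nat \<Rightarrow> real"
    using that summable_on_UNIV_nonneg_real_iff[of "\<lambda>i. \<bar>b i\<bar>"]
      abs_summable_nat(2)[of "\<lambda>i. \<bar>b i\<bar>"] unfolding seq_norm_def
    by (simp add: sums_iff)
  have "seq_norm (volterra \<sigma> a) = (\<Sum>i. \<bar>volterra \<sigma> a (Suc i)\<bar>) + \<bar>volterra \<sigma> a 0\<bar>"
    using suminf_split_head[OF s'] eq[OF s'] by simp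
  also have "\<dots> \<le> seq_norm a + seq_norm a"
  proof (rule add_mono)
    show "(\<Sum>i. \<bar>volterra \<sigma> a (Suc i)\<bar>) \<le> seq_norm a"
      unfolding eq[OF a] by (rule suminf_le[OF le s a])
    show "\<bar>volterra \<sigma> a 0\<bar> \<le> seq_norm a"
      using abs_infsum_weighted_le[OF assms(1) volterra_weight[OF assms(2)]]
      by (simp add: volterra_def)
  qed
  finally show "seq_norm (volterra \<sigma> a) \<le> 2 * seq_norm a" by simp
qed

lemma ell1_seq_volterra_funpow:
  "ell1_seq a \<Longrightarrow> \<sigma> \<in> {0..1} \<Longrightarrow> ell1_seq ((volterra \<sigma> ^^ n) a)"
  by (induction n) (auto intro: ell1_seq_volterra)

lemma seq_norm_volterra_funpow:
  assumes "ell1_seq a" "\<sigma> \<in> {0..1}"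
  shows "seq_norm ((volterra \<sigma> ^^ n) a) \<le> 2 ^ n * seq_norm a"
proof (induction n)
  case (Suc n)
  have "seq_norm ((volterra \<sigma> ^^ Suc n) a) \<le> 2 * seq_norm ((volterra \<sigma> ^^ n) a)"
    using seq_norm_volterra[OF ell1_seq_volterra_funpow[OF assms] assms(2)] by simp
  with Suc show ?case by simp
qed simp

lemma volterra_add:
  assumes "ell1_seq a" "ell1_seq b" "\<sigma> \<in> {0..1}"
  shows "volterra \<sigma> (\<lambda>i. a i + b i) = (\<lambda>i. volterra \<sigma> a i + volterra \<sigma> b i)"
proof
  note w = volterra_weight[OF assms(3)]
  show "volterra \<sigma> (\<lambda>i. a i + b i) i = volterra \<sigma> a i + volterra \<sigma> b i" for i
    using infsum_add[OF ell1_seq_summable[OF assms(1) w] ell1_seq_summable[OF assms(2) w]]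
    by (cases i) (simp_all add: volterra_def distrib_left add_divide_distrib del: power_Suc)
qed

lemma volterra_scale: "volterra \<sigma> (\<lambda>i. c * a i) = (\<lambda>i. c * volterra \<sigma> a i)"
proof
  show "volterra \<sigma> (\<lambda>i. c * a i) i = c * volterra \<sigma> a i" for i
    using infsum_cmult_right'[of c "\<lambda>m. \<sigma> ^ Suc m / real (Suc m) * a m" UNIV]
    by (cases i) (simp_all add: volterra_def mult.left_commute del: power_Suc)
qed

text \<open>
  The pairing is an unordered sum; termwise differentiation needs the power series in its natural
  order.
\<close>

lemma power_function_sums:
  assumes "ell1_seq a" "s \<in> {0..1}"
  shows "(\<lambda>i. a i * s ^ i) sums pairing (eta s) a"
proof -
  have "ell1_seq (\<lambda>i. eta s i * a i)"
    using assms(1) eta_le_1[OF assms(2)] by (rule ell1_seq_weighted)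
  from abs_summable_nat(2)[OF this[unfolded ell1_seq_def]] show ?thesis
    by (simp add: pairing_def eta_def mult.commute)
qed

lemma continuous_on_power_function:
  assumes "ell1_seq a"
  shows "continuous_on {0..1} (\<lambda>s. pairing (eta s) a)"
  unfolding pairing_def
proof (rule uniform_limit_theorem[OF _ Weierstrass_m_test_general])
  show "(\<lambda>i. \<bar>a i\<bar>) summable_on UNIV" using assms by (simp add: ell1_seq_def)
  show "norm (eta s i * a i) \<le> \<bar>a i\<bar>" if "s \<in> {0..1}" for i s
    using eta_le_1[OF that] by (auto simp: abs_mult intro: mult_left_le_one_le)
  show "\<forall>\<^sub>F F in finite_subsets_at_top UNIV. continuous_on {0..1} (\<lambda>s. \<Sum>i\<in>F. eta s i * a i)"
    unfolding eta_def by (intro always_eventually allI continuous_intros)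
qed simp

text \<open>
  Termwise differentiation discards the constant of integration and cancels the factors
  \<open>1 / (m + 1)\<close>: in terms of coefficients, \<open>diffs (volterra \<sigma> a) = a\<close>.
\<close>

lemma volterra_has_derivative:
  assumes "ell1_seq a" "\<sigma> \<in> {0..1}" "s \<in> {0<..<1}"
  shows "((\<lambda>s. pairing (eta s) (volterra \<sigma> a)) has_real_derivative pairing (eta s) a) (at s)"
proof -
  have v: "ell1_seq (volterra \<sigma> a)" using assms by (intro ell1_seq_volterra)
  have "((\<lambda>s. \<Sum>i. volterra \<sigma> a i * s ^ i) has_real_derivative
          (\<Sum>i. diffs (volterra \<sigma> a) i * s ^ i)) (at s)"
    by (rule termdiffs_strong[where K = 1])
       (use power_function_sums[OF v, of 1] assms in \<open>auto simp: sums_iff\<close>)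
  also have "diffs (volterra \<sigma> a) = a"
    by (auto simp: diffs_def volterra_def)
  also have "(\<Sum>i. a i * s ^ i) = pairing (eta s) a"
    using power_function_sums[OF assms(1), of s] assms(3) by (auto simp: sums_iff)
  finally show ?thesis
  proof (rule has_field_derivative_transform_within_open[of _ _ _ "{0<..<1}"])
    show "(\<Sum>i. volterra \<sigma> a i * u ^ i) = pairing (eta u) (volterra \<sigma> a)" if "u \<in> {0<..<1}" for u
      using power_function_sums[OF v, of u] that by (auto simp: sums_iff)
  qed (use assms in auto)
qed

text \<open>
  Edge data need not be images under the Volterra operator, so the first Picard term, which
  consists of them, needs its differentiability from here.
\<close>

lemma power_function_differentiable:
  assumes "ell1_seq a" "s \<in> {0<..<1}"
  shows "((\<lambda>s. pairing (eta s) a) has_real_derivative (\<Sum>i. diffs a i * s ^ i)) (at s)"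
proof -
  have "((\<lambda>s. \<Sum>i. a i * s ^ i) has_real_derivative (\<Sum>i. diffs a i * s ^ i)) (at s)"
    by (rule termdiffs_strong[where K = 1])
       (use power_function_sums[OF assms(1), of 1] assms in \<open>auto simp: sums_iff\<close>)
  then show ?thesis
  proof (rule has_field_derivative_transform_within_open[of _ _ _ "{0<..<1}"])
    show "(\<Sum>i. a i * u ^ i) = pairing (eta u) a" if "u \<in> {0<..<1}" for u
      using power_function_sums[OF assms(1), of u] that by (auto simp: sums_iff)
  qed (use assms in auto)
qed

lemma volterra_vanishes:
  assumes "ell1_seq a" "\<sigma> \<in> {0..1}"
  shows "pairing (eta \<sigma>) (volterra \<sigma> a) = 0"
proof -
  have "ell1_seq (\<lambda>m. \<sigma> ^ Suc m / real (Suc m) * a m)"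
    using assms(1) volterra_weight[OF assms(2)] by (rule ell1_seq_weighted)
  from abs_summable_nat(2)[OF this[unfolded ell1_seq_def]]
  have "(\<lambda>m. volterra \<sigma> a (Suc m) * \<sigma> ^ Suc m) sums (- volterra \<sigma> a 0)"
    by (simp add: volterra_def mult.commute del: power_Suc)
  then have "(\<lambda>i. volterra \<sigma> a i * \<sigma> ^ i) sums 0"
    by (subst (asm) sums_Suc_iff) simp
  with power_function_sums[OF ell1_seq_volterra[OF assms] assms(2)] show ?thesis
    by (rule sums_unique2)
qed

text \<open>
  These are the coefficients of \<open>(s - \<sigma>)\<^sup>n / n!\<close>, the \<open>n\<close>-fold antiderivative of 1 from \<open>\<sigma>\<close>. The higher
  coefficients follow by shifting; the constant one is correct because the polynomial vanishes at
  \<open>\<sigma>\<close>, which is the binomial theorem for \<open>(\<sigma> - \<sigma>)\<^bsup>n+1\<^esup>\<close>.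
\<close>

lemma volterra_funpow_kron:
  "(volterra \<sigma> ^^ n) (kron 0) i = (if i \<le> n then (- \<sigma>) ^ (n - i) / (fact i * fact (n - i)) else 0)"
proof (induction n arbitrary: i)
  case 0
  show ?case by (auto simp: kron_def)
next
  case (Suc n)
  let ?b = "(volterra \<sigma> ^^ n) (kron 0)"
  show ?case
  proof (cases i)
    case (Suc m)
    then show ?thesis by (auto simp: volterra_Suc Suc.IH)
  next
    case 0
    have "(\<Sum>\<^sub>\<infinity>m. \<sigma> ^ Suc m / real (Suc m) * ?b m) = (\<Sum>\<^sub>\<infinity>m\<in>{..n}. \<sigma> ^ Suc m / real (Suc m) * ?b m)"
      by (rule infsum_cong_neutral) (auto simp: Suc.IH)
    also have "\<dots> = (\<Sum>m\<le>n. \<sigma> ^ Suc m * (- \<sigma>) ^ (n - m) / (fact (Suc m) * fact (n - m)))"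
      by (simp add: Suc.IH ac_simps)
    also have "\<dots> = (\<Sum>j\<le>Suc n. \<sigma> ^ j * (- \<sigma>) ^ (Suc n - j) / (fact j * fact (Suc n - j)))
        - (- \<sigma>) ^ Suc n / fact (Suc n)"
      by (subst sum.atMost_Suc_shift) simp
    also have "(\<Sum>j\<le>Suc n. \<sigma> ^ j * (- \<sigma>) ^ (Suc n - j) / (fact j * fact (Suc n - j)))
        = (\<Sum>j\<le>Suc n. real (Suc n choose j) * \<sigma> ^ j * (- \<sigma>) ^ (Suc n - j)) / fact (Suc n)"
      unfolding sum_divide_distrib
      by (rule sum.cong) (auto simp: binomial_fact field_simps simp del: fact_Suc power_Suc)
    also have "(\<Sum>j\<le>Suc n. real (Suc n choose j) * \<sigma> ^ j * (- \<sigma>) ^ (Suc n - j)) = (\<sigma> + - \<sigma>) ^ Suc n"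
      by (subst binomial_ring) simp
    finally show ?thesis using 0 by (simp add: volterra_0 del: power_Suc fact_Suc of_nat_Suc)
  qed
qed

text \<open>
  The crude bound \<open>2\<^sup>n\<close> from the operator norm would make the Picard series converge only for small
  \<open>\<rho>\<close>; the factorial, which makes it converge always, is gained on the constant function.
\<close>

lemma seq_norm_volterra_funpow_kron:
  assumes "\<sigma> \<in> {0..1}"
  shows "seq_norm ((volterra \<sigma> ^^ n) (kron 0)) \<le> 2 ^ n / fact n"
proof -
  have "seq_norm ((volterra \<sigma> ^^ n) (kron 0)) = (\<Sum>\<^sub>\<infinity>i\<in>{..n}. \<bar>(volterra \<sigma> ^^ n) (kron 0) i\<bar>)"
    unfolding seq_norm_def by (rule infsum_cong_neutral) (auto simp: volterra_funpow_kron)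
  also have "\<dots> = (\<Sum>i\<le>n. \<sigma> ^ (n - i) / (fact i * fact (n - i)))"
    using assms by (simp add: volterra_funpow_kron abs_mult power_abs)
  also have "\<dots> \<le> (\<Sum>i\<le>n. 1 / (fact i * fact (n - i)))"
    using assms by (intro sum_mono divide_right_mono power_le_one) auto
  also have "\<dots> = (\<Sum>i\<le>n. real (n choose i)) / fact n"
    unfolding sum_divide_distrib by (rule sum.cong) (auto simp: binomial_fact)
  also have "(\<Sum>i\<le>n. real (n choose i)) = 2 ^ n"
    using choose_row_sum[of n] by (metis of_nat_numeral of_nat_power of_nat_sum)
  finally show ?thesis .
qed

section \<open>Absolutely summable matrices and induced functions\<close>

lemma ell1_norm_nonneg: "ell1_norm C \<ge> 0"
  unfolding ell1_norm_def by (rule infsum_nonneg) auto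

lemma ell1_mat_dominated:
  assumes "(\<lambda>(i, j). D i j) summable_on UNIV" "\<And>i j. \<bar>C i j\<bar> \<le> (D i j :: real)"
  shows "ell1_mat C" "ell1_norm C \<le> (\<Sum>\<^sub>\<infinity>(i, j)\<in>UNIV. D i j)"
proof -
  show *: "ell1_mat C"
    using assms unfolding ell1_mat_def
    by - (rule summable_on_comparison_test[where f = "\<lambda>(i, j). D i j"], auto)
  show "ell1_norm C \<le> (\<Sum>\<^sub>\<infinity>(i, j)\<in>UNIV. D i j)"
    unfolding ell1_norm_def
    by (rule infsum_mono) (use * assms in \<open>auto simp: ell1_mat_def\<close>)
qed

lemma ell1_mat_add:
  assumes "ell1_mat A" "ell1_mat B"
  shows "ell1_mat (\<lambda>i j. A i j + B i j)"
    and "ell1_norm (\<lambda>i j. A i j + B i j) \<le> ell1_norm A + ell1_norm B"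
proof -
  note s = assms[unfolded ell1_mat_def]
  have *: "(\<lambda>(i, j). \<bar>A i j\<bar> + \<bar>B i j\<bar>) summable_on UNIV"
    using summable_on_add[OF s] by (simp add: case_prod_unfold)
  show "ell1_mat (\<lambda>i j. A i j + B i j)"
    by (rule ell1_mat_dominated[OF *]) simp
  have "ell1_norm (\<lambda>i j. A i j + B i j) \<le> (\<Sum>\<^sub>\<infinity>(i, j)\<in>UNIV. \<bar>A i j\<bar> + \<bar>B i j\<bar>)"
    by (rule ell1_mat_dominated[OF *]) simp
  also have "\<dots> = ell1_norm A + ell1_norm B"
    using infsum_add[OF s] by (simp add: ell1_norm_def case_prod_unfold)
  finally show "ell1_norm (\<lambda>i j. A i j + B i j) \<le> ell1_norm A + ell1_norm B" .
qed

lemma ell1_mat_scale: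
  assumes "ell1_mat A"
  shows "ell1_mat (\<lambda>i j. c * A i j)" "ell1_norm (\<lambda>i j. c * A i j) = \<bar>c\<bar> * ell1_norm A"
  using summable_on_cmult_right[OF assms[unfolded ell1_mat_def], of "\<bar>c\<bar>"]
    infsum_cmult_right'[of "\<bar>c\<bar>" "\<lambda>(i, j). \<bar>A i j\<bar>" UNIV]
  by (simp_all add: ell1_mat_def ell1_norm_def case_prod_unfold abs_mult)

lemma ell1_mat_sum:
  assumes "\<And>n. ell1_mat (T n)"
  shows "ell1_mat (\<lambda>i j. \<Sum>n<(m::nat). T n i j)"
proof (induction m)
  case 0
  show ?case by (simp add: ell1_mat_def case_prod_unfold)
next
  case (Suc m)
  show ?case using ell1_mat_add(1)[OF Suc assms[of m]] by simp
qed

lemma ell1_mat_outer: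
  assumes "ell1_seq a" "ell1_seq b"
  shows "ell1_mat (\<lambda>i j. a i * b j)" "ell1_norm (\<lambda>i j. a i * b j) = seq_norm a * seq_norm b"
proof -
  have b: "((\<lambda>j. \<bar>a i * b j\<bar>) has_sum \<bar>a i\<bar> * seq_norm b) UNIV" for i
    using has_sum_cmult_right[OF has_sum_infsum[OF assms(2)[unfolded ell1_seq_def]], of "\<bar>a i\<bar>"]
    by (simp add: abs_mult seq_norm_def)
  have "(\<lambda>p. \<bar>a (fst p) * b (snd p)\<bar>) summable_on (UNIV \<times> UNIV)"
    by (rule summable_on_SigmaI[where g = "\<lambda>i. \<bar>a i\<bar> * seq_norm b"])
       (use b summable_on_cmult_left[OF assms(1)[unfolded ell1_seq_def]] in auto)
  then have s: "(\<lambda>(i, j). \<bar>a i * b j\<bar>) summable_on (UNIV \<times> UNIV)"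
    by (simp add: case_prod_unfold)
  then show "ell1_mat (\<lambda>i j. a i * b j)"
    by (simp add: ell1_mat_def)
  show "ell1_norm (\<lambda>i j. a i * b j) = seq_norm a * seq_norm b"
    using infsum_Sigma'_banach[OF s] infsumI[OF b]
    by (simp add: ell1_norm_def seq_norm_def infsum_cmult_left')
qed

lemma ell1_mat_transpose:
  assumes "ell1_mat C"
  shows "ell1_mat (inf_transpose C)"
  using assms summable_on_swap[of "\<lambda>(i, j). \<bar>C i j\<bar>" UNIV UNIV]
  by (simp add: ell1_mat_def inf_transpose_def case_prod_unfold)

lemma ell1_seq_inf_mult_vec:
  assumes "ell1_mat C" "t \<in> {0..1}"
  shows "ell1_seq (inf_mult_vec C (eta t))"
proof -
  have s: "(\<lambda>(i, j). \<bar>C i j\<bar>) summable_on (UNIV \<times> UNIV)"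
    using assms(1) by (simp add: ell1_mat_def)
  have row: "ell1_seq (C i)" for i
    using summable_on_SigmaD1[OF s, of i] by (simp add: ell1_seq_def)
  have "(\<lambda>i. seq_norm (C i)) summable_on UNIV"
    using summable_on_SigmaD[OF s] row by (simp add: seq_norm_def ell1_seq_def)
  moreover have "\<bar>inf_mult_vec C (eta t) i\<bar> \<le> seq_norm (C i)" for i
    using abs_infsum_weighted_le[OF row eta_le_1[OF assms(2)]]
    by (simp add: inf_mult_vec_def mult.commute)
  ultimately show ?thesis
    unfolding ell1_seq_def
    by - (rule summable_on_comparison_test[where f = "\<lambda>i. seq_norm (C i)"], auto)
qed

lemma weighted_entry_le:
  assumes "s \<in> {0..1}" "t \<in> {0..1}"
  shows "\<bar>eta s i * (C i j * eta t j)\<bar> \<le> \<bar>C i j\<bar>"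
  using mult_left_le_one_le[of "\<bar>C i j\<bar>" "\<bar>eta s i * eta t j\<bar>"]
    mult_mono[OF eta_le_1[OF assms(1), of i] eta_le_1[OF assms(2), of j]]
  by (simp add: abs_mult ac_simps)

lemma weighted_entries_summable:
  assumes "ell1_mat C" "s \<in> {0..1}" "t \<in> {0..1}"
  shows "(\<lambda>(i, j). eta s i * (C i j * eta t j)) summable_on UNIV"
proof -
  have "ell1_mat (\<lambda>i j. eta s i * (C i j * eta t j))"
    by (rule ell1_mat_dominated(1)[OF assms(1)[unfolded ell1_mat_def]])
       (rule weighted_entry_le[OF assms(2,3)])
  then show ?thesis
    unfolding ell1_mat_def
    by - (rule abs_summable_summable, simp add: case_prod_unfold)
qed

lemma induced_fun_eq_double_sum:
  assumes "ell1_mat C" "s \<in> {0..1}" "t \<in> {0..1}"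
  shows "induced_fun C (s, t) = (\<Sum>\<^sub>\<infinity>(i, j)\<in>UNIV. eta s i * (C i j * eta t j))"
  using infsum_Sigma'_banach[of "\<lambda>i j. eta s i * (C i j * eta t j)" UNIV "\<lambda>_. UNIV"]
    weighted_entries_summable[OF assms]
  by (simp add: induced_fun_def pairing_def inf_mult_vec_def infsum_cmult_right')

text \<open>
  The induced function is defined by summing over columns first. Restricted to a vertical edge it is a
  power series in \<open>t\<close> only after the two summations have been interchanged.
\<close>

lemma induced_fun_transpose:
  assumes "ell1_mat C" "s \<in> {0..1}" "t \<in> {0..1}"
  shows "induced_fun C (s, t) = pairing (eta t) (inf_mult_vec (inf_transpose C) (eta s))"
proof -
  have "induced_fun C (s, t) = (\<Sum>\<^sub>\<infinity>i. \<Sum>\<^sub>\<infinity>j. eta s i * (C i j * eta t j))"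
    by (simp add: induced_fun_def pairing_def inf_mult_vec_def infsum_cmult_right')
  also have "\<dots> = (\<Sum>\<^sub>\<infinity>j. \<Sum>\<^sub>\<infinity>i. eta s i * (C i j * eta t j))"
    using weighted_entries_summable[OF assms] by (intro infsum_swap_banach) simp
  also have "\<dots> = pairing (eta t) (inf_mult_vec (inf_transpose C) (eta s))"
    by (simp add: pairing_def inf_mult_vec_def inf_transpose_def infsum_cmult_right'[symmetric] ac_simps)
  finally show ?thesis .
qed

lemma abs_induced_fun_le:
  assumes "ell1_mat C" "s \<in> {0..1}" "t \<in> {0..1}"
  shows "\<bar>induced_fun C (s, t)\<bar> \<le> ell1_norm C"
  unfolding induced_fun_eq_double_sum[OF assms] ell1_norm_def real_norm_def[symmetric]
  by (rule norm_infsum_le[OF has_sum_infsum[OF weighted_entries_summable[OF assms]] has_sum_infsum])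
     (use assms weighted_entry_le[OF assms(2,3)] in \<open>auto simp: ell1_mat_def\<close>)

lemma induced_fun_add:
  assumes "ell1_mat A" "ell1_mat B" "s \<in> {0..1}" "t \<in> {0..1}"
  shows "induced_fun (\<lambda>i j. A i j + B i j) (s, t) = induced_fun A (s, t) + induced_fun B (s, t)"
  using infsum_add[OF weighted_entries_summable[OF assms(1,3,4)] weighted_entries_summable[OF assms(2-4)]]
  unfolding induced_fun_eq_double_sum[OF assms(1,3,4)] induced_fun_eq_double_sum[OF assms(2-4)]
    induced_fun_eq_double_sum[OF ell1_mat_add(1)[OF assms(1,2)] assms(3,4)]
  by (simp add: case_prod_unfold algebra_simps)

lemma inf_mult_vec_scale: "inf_mult_vec (\<lambda>i j. c i * A i j) a = (\<lambda>i. c i * inf_mult_vec A a i)"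
  by (simp add: inf_mult_vec_def mult.assoc infsum_cmult_right')

lemma induced_fun_scale: "induced_fun (\<lambda>i j. c * A i j) p = c * induced_fun A p"
  by (simp add: induced_fun_def case_prod_unfold inf_mult_vec_scale pairing_def
      infsum_cmult_right'[symmetric] mult.left_commute)

lemma induced_fun_sum:
  assumes "\<And>n. ell1_mat (T n)" "s \<in> {0..1}" "t \<in> {0..1}"
  shows "induced_fun (\<lambda>i j. \<Sum>n<(m::nat). T n i j) (s, t) = (\<Sum>n<m. induced_fun (T n) (s, t))"
proof (induction m)
  case 0
  show ?case using induced_fun_scale[of 0 "T 0" "(s, t)"] by simp
next
  case (Suc m)
  then show ?case
    using induced_fun_add[OF ell1_mat_sum[of T m, OF assms(1)] assms(1)[of m] assms(2,3)] by simp
qed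

lemma induced_fun_outer:
  "induced_fun (\<lambda>i j. a i * b j) (s, t) = pairing (eta s) a * pairing (eta t) b"
proof -
  have "inf_mult_vec (\<lambda>i j. b j) (eta t) = (\<lambda>i. pairing (eta t) b)"
    by (simp add: inf_mult_vec_def pairing_def mult.commute)
  then show ?thesis
    by (simp add: induced_fun_def inf_mult_vec_scale pairing_def infsum_cmult_left'[symmetric]
        mult.assoc)
qed

text \<open>
  Completeness of \<open>\<ell>\<^sub>1\<close>, with the limit given entrywise. Both claims follow from one estimate: over any
  finite set of entries, the remainder after \<open>m\<close> terms is at most the tail of the series of norms.
  The case \<open>m = 0\<close> is summability of the limit.
\<close>

lemma ell1_mat_series:
  assumes T: "\<And>n. ell1_mat (T n)" and summ: "summable (\<lambda>n. ell1_norm (T n))"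
  shows "ell1_mat (\<lambda>i j. \<Sum>n. T n i j)"
    and "(\<lambda>m. ell1_norm (\<lambda>i j. (\<Sum>n. T n i j) - (\<Sum>n\<le>m. T n i j))) \<longlonglongrightarrow> 0"
proof -
  let ?D = "\<lambda>m i j. (\<Sum>n. T n i j) - (\<Sum>n<m. T n i j)"
  define tail where "tail m = (\<Sum>n. ell1_norm (T (n + m)))" for m
  have fin: "(\<Sum>(i, j)\<in>F. \<bar>T n i j\<bar>) \<le> ell1_norm (T n)" if "finite F" for F n
    unfolding ell1_norm_def
    by (rule finite_sum_le_infsum) (use that T in \<open>auto simp: ell1_mat_def\<close>)
  have abs: "summable (\<lambda>n. \<bar>T n i j\<bar>)" for i j
    by (rule summable_comparison_test'[OF summ, of 0]) (use fin[of "{(i, j)}"] in auto)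
  have D: "?D m i j = (\<Sum>n. T (n + m) i j)" for m i j
    using suminf_minus_initial_segment[where f = "\<lambda>n. T n i j", OF summable_rabs_cancel[OF abs]] by simp
  have sums: "(\<Sum>(i, j)\<in>F. \<bar>?D m i j\<bar>) \<le> tail m" if F: "finite F" for F m
  proof -
    have sh: "summable (\<lambda>n. \<bar>T (n + m) i j\<bar>)" for i j
      using summable_ignore_initial_segment[OF abs[of i j], of m] .
    have "(\<Sum>(i, j)\<in>F. \<bar>?D m i j\<bar>) \<le> (\<Sum>(i, j)\<in>F. \<Sum>n. \<bar>T (n + m) i j\<bar>)"
      unfolding D using summable_rabs[OF sh] by (intro sum_mono) auto
    also have "\<dots> = (\<Sum>n. \<Sum>(i, j)\<in>F. \<bar>T (n + m) i j\<bar>)"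
      unfolding case_prod_unfold by (rule suminf_sum[symmetric]) (rule sh)
    also have "\<dots> \<le> tail m"
      unfolding tail_def
    proof (rule suminf_le)
      show "summable (\<lambda>n. \<Sum>(i, j)\<in>F. \<bar>T (n + m) i j\<bar>)"
        unfolding case_prod_unfold by (rule summable_sum) (rule sh)
    qed (use fin[OF F] summable_ignore_initial_segment[OF summ] in auto)
    finally show ?thesis .
  qed
  have mat: "ell1_mat (?D m)" for m
    unfolding ell1_mat_def
    by (rule nonneg_bdd_above_summable_on)
       (use sums[of _ m] in \<open>auto simp: bdd_above_def case_prod_unfold\<close>)
  have norm: "ell1_norm (?D m) \<le> tail m" for m
    unfolding ell1_norm_def
    by (rule infsum_le_finite_sums) (use sums[of _ m] mat[of m] in \<open>auto simp: ell1_mat_def\<close>)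
  show "ell1_mat (\<lambda>i j. \<Sum>n. T n i j)"
    using mat[of 0] by simp
  have "tail = (\<lambda>m. (\<Sum>n. ell1_norm (T n)) - (\<Sum>n<m. ell1_norm (T n)))"
    using suminf_minus_initial_segment[OF summ] by (auto simp: tail_def)
  moreover have "(\<lambda>m. (\<Sum>n. ell1_norm (T n)) - (\<Sum>n<m. ell1_norm (T n))) \<longlonglongrightarrow>
      (\<Sum>n. ell1_norm (T n)) - (\<Sum>n. ell1_norm (T n))"
    by (intro tendsto_intros summable_LIMSEQ summ)
  ultimately have tail: "tail \<longlonglongrightarrow> 0" by simp
  have "(\<lambda>m. ell1_norm (?D m)) \<longlonglongrightarrow> 0"
    by (rule tendsto_sandwich[OF _ _ tendsto_const tail])
       (auto simp: norm ell1_norm_nonneg)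
  from LIMSEQ_Suc[OF this]
  show "(\<lambda>m. ell1_norm (\<lambda>i j. (\<Sum>n. T n i j) - (\<Sum>n\<le>m. T n i j))) \<longlonglongrightarrow> 0"
    by (simp add: lessThan_Suc_atMost)
qed

section \<open>A mean value estimate for the Goursat problem\<close>

text \<open>
  Integrating \<open>|f'| \<le> B (x - a)\<^sup>n\<close> over \<open>[p, q]\<close>. The bound keeps the base point \<open>a\<close>, to the left of \<open>p\<close>, so
  that it does not depend on \<open>p\<close>, and \<open>p\<close> can tend to \<open>a\<close> afterwards.
\<close>

lemma DERIV_bound_power:
  fixes f :: "real \<Rightarrow> real"
  assumes "p \<le> q" "a \<le> p"
    and deriv: "\<And>x. p \<le> x \<Longrightarrow> x \<le> q \<Longrightarrow> (f has_real_derivative f' x) (at x)"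
    and bound: "\<And>x. p \<le> x \<Longrightarrow> x \<le> q \<Longrightarrow> \<bar>f' x\<bar> \<le> B * (x - a) ^ n"
    and "B \<ge> 0"
  shows "\<bar>f q - f p\<bar> \<le> B / Suc n * (q - a) ^ Suc n"
proof (cases "p = q")
  case True
  then show ?thesis using assms by simp
next
  case False
  let ?\<phi> = "\<lambda>x. B / Suc n * (x - a) ^ Suc n"
  have \<phi>: "(?\<phi> has_real_derivative B * (x - a) ^ n) (at x)" for x
    by (rule derivative_eq_intros refl | simp del: power_Suc)+
  have "norm (f q - f p) \<le> ?\<phi> q - ?\<phi> p"
  proof (rule differentiable_bound_general)
    show "continuous_on {p..q} f"
      using deriv by (intro DERIV_continuous_on) (auto intro: has_field_derivative_at_within)
    show "continuous_on {p..q} ?\<phi>" by (intro continuous_intros)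
    show "(f has_vector_derivative f' x) (at x)" if "p < x" "x < q" for x
      using deriv[of x] that by (simp add: has_real_derivative_iff_has_vector_derivative)
    show "(?\<phi> has_vector_derivative B * (x - a) ^ n) (at x)" for x
      using \<phi>[of x] by (simp only: has_real_derivative_iff_has_vector_derivative)
    show "norm (f' x) \<le> B * (x - a) ^ n" if "p < x" "x < q" for x
      using bound[of x] that by simp
  qed (use False \<open>p \<le> q\<close> in auto)
  moreover have "?\<phi> p \<ge> 0" using assms by simp
  ultimately show ?thesis by simp
qed

text \<open>
  A bound on the mixed derivative \<open>g\<close>, integrated once in each variable, bounds \<open>u\<close>. The derivatives
  are available only in the open rectangle, so the estimate is first made for the mixed difference
  of \<open>u\<close> over \<open>[p, s] \<times> [q, t]\<close> with all corners inside; then \<open>p\<close> and \<open>q\<close> move to the edges, where \<open>u\<close>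
  vanishes, and finally \<open>(s, t)\<close> is allowed to reach the boundary.
\<close>

lemma goursat_bound:
  fixes u :: "real \<times> real \<Rightarrow> real"
  assumes "a < b" "c < d"
    and cont: "continuous_on ({a..b} \<times> {c..d}) u"
    and left: "\<And>t. t \<in> {c..d} \<Longrightarrow> u (a, t) = 0"
    and bottom: "\<And>s. s \<in> {a..b} \<Longrightarrow> u (s, c) = 0"
    and dt: "\<And>s t. s \<in> {a<..<b} \<Longrightarrow> t \<in> {c<..<d} \<Longrightarrow>
      ((\<lambda>t. u (s, t)) has_real_derivative v s t) (at t)"
    and ds: "\<And>s t. s \<in> {a<..<b} \<Longrightarrow> t \<in> {c<..<d} \<Longrightarrow>
      ((\<lambda>s. v s t) has_real_derivative g s t) (at s)"
    and bound: "\<And>s t. s \<in> {a<..<b} \<Longrightarrow> t \<in> {c<..<d} \<Longrightarrow>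
      \<bar>g s t\<bar> \<le> B * (s - a) ^ n * (t - c) ^ n"
    and "B \<ge> 0"
    and st: "s \<in> {a..b}" "t \<in> {c..d}"
  shows "\<bar>u (s, t)\<bar> \<le> B / (real (Suc n))\<^sup>2 * (s - a) ^ Suc n * (t - c) ^ Suc n"
proof -
  let ?E = "\<lambda>s t. B / (real (Suc n))\<^sup>2 * (s - a) ^ Suc n * (t - c) ^ Suc n"
  have mixed: "\<bar>(u (s, t) - u (p, t)) - (u (s, q) - u (p, q))\<bar> \<le> ?E s t"
    if "p \<in> {a<..<s}" "q \<in> {c<..<t}" "s \<in> {a<..<b}" "t \<in> {c<..<d}" for p q s t
  proof -
    have inner: "\<bar>v s y - v p y\<bar> \<le> (B / Suc n * (s - a) ^ Suc n) * (y - c) ^ n"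
      if "q \<le> y" "y \<le> t" for y
    proof -
      have y: "y \<in> {c<..<d}" using that \<open>q \<in> _\<close> \<open>t \<in> _\<close> by auto
      have "\<bar>v s y - v p y\<bar> \<le> B * (y - c) ^ n / Suc n * (s - a) ^ Suc n"
      proof (rule DERIV_bound_power)
        show "((\<lambda>x. v x y) has_real_derivative g x y) (at x)" if "p \<le> x" "x \<le> s" for x
          using that \<open>p \<in> _\<close> \<open>s \<in> _\<close> y by (intro ds) auto
        show "\<bar>g x y\<bar> \<le> B * (y - c) ^ n * (x - a) ^ n" if "p \<le> x" "x \<le> s" for x
          using bound[of x y] that \<open>p \<in> _\<close> \<open>s \<in> _\<close> y by (auto simp: ac_simps)
      qed (use \<open>p \<in> _\<close> y \<open>B \<ge> 0\<close> in auto)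
      then show ?thesis by (simp add: ac_simps)
    qed
    have "\<bar>(u (s, t) - u (p, t)) - (u (s, q) - u (p, q))\<bar>
        \<le> (B / Suc n * (s - a) ^ Suc n) / Suc n * (t - c) ^ Suc n"
    proof (rule DERIV_bound_power[where f = "\<lambda>t. u (s, t) - u (p, t)"])
      show "((\<lambda>t. u (s, t) - u (p, t)) has_real_derivative v s y - v p y) (at y)"
        if "q \<le> y" "y \<le> t" for y
        using that \<open>p \<in> _\<close> \<open>q \<in> _\<close> \<open>s \<in> _\<close> \<open>t \<in> _\<close> by (intro DERIV_diff dt) auto
    qed (use inner \<open>p \<in> _\<close> \<open>q \<in> _\<close> \<open>s \<in> _\<close> \<open>B \<ge> 0\<close> in auto)
    then show ?thesis by (simp add: power2_eq_square del: power_Suc of_nat_Suc)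
  qed
  have open_bound: "\<bar>u (s, t)\<bar> \<le> ?E s t" if st: "s \<in> {a<..<b}" "t \<in> {c<..<d}" for s t
  proof -
    have lim_s: "((\<lambda>p. u (p, y)) \<longlongrightarrow> u (a, y)) (at_right a)" if "y \<in> {c..d}" for y
    proof -
      have "continuous_on {a..b} (\<lambda>p. u (p, y))"
        by (rule continuous_on_compose2[OF cont]) (use that in \<open>auto intro!: continuous_intros\<close>)
      then have "((\<lambda>p. u (p, y)) \<longlongrightarrow> u (a, y)) (at a within {a..b})"
        using \<open>a < b\<close> by (simp add: continuous_on)
      then show ?thesis using \<open>a < b\<close> by (simp add: at_within_Icc_at_right)
    qed
    have *: "\<bar>u (s, t) - u (s, q)\<bar> \<le> ?E s t" if q: "q \<in> {c<..<t}" for q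
    proof (rule tendsto_upperbound)
      have "((\<lambda>p. \<bar>(u (s, t) - u (p, t)) - (u (s, q) - u (p, q))\<bar>) \<longlongrightarrow>
          \<bar>(u (s, t) - u (a, t)) - (u (s, q) - u (a, q))\<bar>) (at_right a)"
        by (intro tendsto_intros lim_s) (use st q in auto)
      then show "((\<lambda>p. \<bar>(u (s, t) - u (p, t)) - (u (s, q) - u (p, q))\<bar>) \<longlongrightarrow>
          \<bar>u (s, t) - u (s, q)\<bar>) (at_right a)"
        using left[of t] left[of q] st q by simp
      show "\<forall>\<^sub>F p in at_right a. \<bar>(u (s, t) - u (p, t)) - (u (s, q) - u (p, q))\<bar> \<le> ?E s t"
        by (rule eventually_at_rightI[where b = s]) (use mixed[OF _ q st] st in auto)
    qed simp
    show ?thesis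
    proof (rule tendsto_upperbound)
      have "continuous_on {c..d} (\<lambda>q. u (s, q))"
        by (rule continuous_on_compose2[OF cont]) (use st in \<open>auto intro!: continuous_intros\<close>)
      then have "((\<lambda>q. u (s, q)) \<longlongrightarrow> u (s, c)) (at c within {c..d})"
        using \<open>c < d\<close> by (simp add: continuous_on)
      then have "((\<lambda>q. u (s, q)) \<longlongrightarrow> 0) (at_right c)"
        using \<open>c < d\<close> bottom[of s] st by (simp add: at_within_Icc_at_right)
      from tendsto_rabs[OF tendsto_diff[OF tendsto_const[of "u (s, t)"] this]]
      show "((\<lambda>q. \<bar>u (s, t) - u (s, q)\<bar>) \<longlongrightarrow> \<bar>u (s, t)\<bar>) (at_right c)" by simp
      show "\<forall>\<^sub>F q in at_right c. \<bar>u (s, t) - u (s, q)\<bar> \<le> ?E s t"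
        by (rule eventually_at_rightI[where b = t]) (use * st in auto)
    qed simp
  qed
  let ?S = "{a<..<b} \<times> {c<..<d}"
  have cl: "closure ?S = {a..b} \<times> {c..d}"
    using assms(1,2) by (simp add: closure_Times)
  have "(\<lambda>x. \<bar>u x\<bar> - ?E (fst x) (snd x)) (s, t) \<le> 0"
  proof (rule continuous_le_on_closure[of ?S])
    show "continuous_on (closure ?S) (\<lambda>x. \<bar>u x\<bar> - ?E (fst x) (snd x))"
      unfolding cl by (intro continuous_intros cont)
  qed (use st open_bound cl in auto)
  then show ?thesis by simp
qed

section \<open>Picard iteration as a recursion of matrices\<close>

text \<open>
  Subtracting \<open>H(\<sigma>)\<close> only changes row zero: it puts there minus the value at \<open>\<sigma>\<close> of the termwise
  antiderivative, that is, the constant of integration. So \<open>L\<^sub>\<sigma>\<close> integrates every column.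
\<close>

lemma inf_mult_mat_L: "inf_mult (mat_L \<sigma>) M i j = volterra \<sigma> (\<lambda>m. M m j) i"
proof -
  have L: "mat_L \<sigma> i m = (kron i (Suc m) - \<sigma> ^ Suc m * kron i 0) / real (Suc m)" for i m
    unfolding mat_L_def inf_mult_def
    by (subst infsum_singleton_support[where k = "Suc m"])
       (auto simp: mat_I_def mat_H_def mat_S_def kron_def)
  show ?thesis
  proof (cases i)
    case 0
    have "inf_mult (mat_L \<sigma>) M i j = (\<Sum>\<^sub>\<infinity>m. - (\<sigma> ^ Suc m / real (Suc m) * M m j))"
      unfolding inf_mult_def L 0 by (simp add: kron_def)
    then show ?thesis using 0 by (simp add: volterra_def infsum_uminus del: power_Suc)
  next
    case (Suc k)
    show ?thesis
      unfolding inf_mult_def L Suc volterra_Suc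
      by (subst infsum_singleton_support[where k = k]) (auto simp: kron_def)
  qed
qed

lemma inf_mult_mat_R: "inf_mult M (mat_R \<tau>) i j = volterra \<tau> (\<lambda>m. M i m) j"
proof -
  have R: "mat_R \<tau> m j = (kron (Suc m) j - \<tau> ^ Suc m * kron 0 j) / real (Suc m)" for j m
    unfolding mat_R_def inf_mult_def
    by (subst infsum_singleton_support[where k = "Suc m"])
       (auto simp: mat_I_def mat_G_def mat_T_def kron_def)
  show ?thesis
  proof (cases j)
    case 0
    have "inf_mult M (mat_R \<tau>) i j = (\<Sum>\<^sub>\<infinity>m. - (\<tau> ^ Suc m / real (Suc m) * M i m))"
      unfolding inf_mult_def R 0 by (simp add: kron_def mult.commute)
    then show ?thesis using 0 by (simp add: volterra_def infsum_uminus del: power_Suc)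
  next
    case (Suc k)
    show ?thesis
      unfolding inf_mult_def R Suc volterra_Suc
      by (subst infsum_singleton_support[where k = k]) (auto simp: kron_def)
  qed
qed

text \<open>
  The closed form of the matrix recursion: \<open>\<alpha>\<close> and \<open>\<beta>\<close> are the coefficients of the data on the bottom
  and left edge, and \<open>\<gamma>\<close> is their common value at the corner.
\<close>

definition picard_coeff ::
  "real \<Rightarrow> real \<Rightarrow> real \<Rightarrow> (nat \<Rightarrow> real) \<Rightarrow> (nat \<Rightarrow> real) \<Rightarrow> real \<Rightarrow> nat \<Rightarrow> infmat" where
  "picard_coeff r \<sigma> \<tau> \<alpha> \<beta> \<gamma> n = (\<lambda>i j. r ^ n *
     ((volterra \<sigma> ^^ n) \<alpha> i * (volterra \<tau> ^^ n) (kron 0) j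
      + (volterra \<sigma> ^^ n) (kron 0) i * (volterra \<tau> ^^ n) \<beta> j
      + (- \<gamma>) * ((volterra \<sigma> ^^ n) (kron 0) i * (volterra \<tau> ^^ n) (kron 0) j)))"

definition picard_fun ::
  "real \<Rightarrow> real \<Rightarrow> real \<Rightarrow> (nat \<Rightarrow> real) \<Rightarrow> (nat \<Rightarrow> real) \<Rightarrow> real \<Rightarrow> nat \<Rightarrow> real \<Rightarrow> real \<Rightarrow> real" where
  "picard_fun r \<sigma> \<tau> \<alpha> \<beta> \<gamma> n s t = r ^ n *
     (pairing (eta s) ((volterra \<sigma> ^^ n) \<alpha>) * pairing (eta t) ((volterra \<tau> ^^ n) (kron 0))
      + pairing (eta s) ((volterra \<sigma> ^^ n) (kron 0)) * pairing (eta t) ((volterra \<tau> ^^ n) \<beta>)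
      - \<gamma> * (pairing (eta s) ((volterra \<sigma> ^^ n) (kron 0)) *
             pairing (eta t) ((volterra \<tau> ^^ n) (kron 0))))"

lemma volterra_lincomb:
  assumes "ell1_seq a" "ell1_seq b" "\<sigma> \<in> {0..1}"
  shows "volterra \<sigma> (\<lambda>i. c * a i + d * b i) = (\<lambda>i. c * volterra \<sigma> a i + d * volterra \<sigma> b i)"
  using volterra_add[OF ell1_seq_scale[OF assms(1), of c] ell1_seq_scale[OF assms(2), of d] assms(3)]
  by (simp add: volterra_scale)

text \<open>
  An outer product is mapped to the outer product of the integrated factors; for a sum of outer
  products this is linearity of the Volterra operator, used once on columns and once on rows.
\<close>

lemma picard_coeff_Suc:
  assumes "ell1_seq \<alpha>" "ell1_seq \<beta>" "\<sigma> \<in> {0..1}" "\<tau> \<in> {0..1}"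
  shows "picard_coeff r \<sigma> \<tau> \<alpha> \<beta> \<gamma> (Suc n) =
    (\<lambda>i j. r * inf_mult (inf_mult (mat_L \<sigma>) (picard_coeff r \<sigma> \<tau> \<alpha> \<beta> \<gamma> n)) (mat_R \<tau>) i j)"
proof (intro ext)
  fix i j
  let ?a = "(volterra \<sigma> ^^ n) \<alpha>" and ?p = "(volterra \<sigma> ^^ n) (kron 0)"
  let ?b = "(volterra \<tau> ^^ n) \<beta>" and ?q = "(volterra \<tau> ^^ n) (kron 0)"
  note l1 = ell1_seq_volterra_funpow[OF _ assms(3)] ell1_seq_volterra_funpow[OF _ assms(4)]
  let ?M = "inf_mult (mat_L \<sigma>) (picard_coeff r \<sigma> \<tau> \<alpha> \<beta> \<gamma> n)"
  have "picard_coeff r \<sigma> \<tau> \<alpha> \<beta> \<gamma> n = (\<lambda>i j. r ^ n * ?q j * ?a i + r ^ n * (?b j - \<gamma> * ?q j) * ?p i)"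
    by (simp add: picard_coeff_def fun_eq_iff algebra_simps)
  then have "?M i m = r ^ n * ?q m * volterra \<sigma> ?a i + r ^ n * (?b m - \<gamma> * ?q m) * volterra \<sigma> ?p i" for m
    using volterra_lincomb[OF l1(1)[OF assms(1)] l1(1)[OF ell1_seq_kron] assms(3),
        where c = "r ^ n * ?q m" and d = "r ^ n * (?b m - \<gamma> * ?q m)"]
    by (simp add: inf_mult_mat_L)
  then have "?M i = (\<lambda>m. r ^ n * (volterra \<sigma> ?a i - \<gamma> * volterra \<sigma> ?p i) * ?q m
      + r ^ n * volterra \<sigma> ?p i * ?b m)"
    by (simp add: fun_eq_iff algebra_simps)
  then show "picard_coeff r \<sigma> \<tau> \<alpha> \<beta> \<gamma> (Suc n) i j = r * inf_mult ?M (mat_R \<tau>) i j"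
    using volterra_lincomb[OF l1(2)[OF ell1_seq_kron] l1(2)[OF assms(2)] assms(4),
        where c = "r ^ n * (volterra \<sigma> ?a i - \<gamma> * volterra \<sigma> ?p i)"
          and d = "r ^ n * volterra \<sigma> ?p i"]
    by (simp add: inf_mult_mat_R picard_coeff_def algebra_simps)
qed

text \<open>
  In each of the three outer products one factor is an iterate of the constant function, of norm at
  most \<open>2\<^sup>n / n!\<close>, and the other one is at most \<open>2\<^sup>n\<close> times the norm of its initial value.
\<close>

lemma
  assumes "ell1_seq \<alpha>" "ell1_seq \<beta>" "\<sigma> \<in> {0..1}" "\<tau> \<in> {0..1}"
  shows ell1_mat_picard_coeff: "ell1_mat (picard_coeff r \<sigma> \<tau> \<alpha> \<beta> \<gamma> n)"
    and ell1_norm_picard_coeff: "ell1_norm (picard_coeff r \<sigma> \<tau> \<alpha> \<beta> \<gamma> n)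
      \<le> (seq_norm \<alpha> + seq_norm \<beta> + \<bar>\<gamma>\<bar>) * ((4 * \<bar>r\<bar>) ^ n / fact n)"
    and induced_fun_picard_coeff: "s \<in> {0..1} \<Longrightarrow> t \<in> {0..1} \<Longrightarrow>
      induced_fun (picard_coeff r \<sigma> \<tau> \<alpha> \<beta> \<gamma> n) (s, t) = picard_fun r \<sigma> \<tau> \<alpha> \<beta> \<gamma> n s t"
proof -
  let ?a = "(volterra \<sigma> ^^ n) \<alpha>" and ?p = "(volterra \<sigma> ^^ n) (kron 0)"
  let ?b = "(volterra \<tau> ^^ n) \<beta>" and ?q = "(volterra \<tau> ^^ n) (kron 0)"
  note l1 = ell1_seq_volterra_funpow[OF assms(1,3), of n]
    ell1_seq_volterra_funpow[OF ell1_seq_kron assms(3), of n]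
    ell1_seq_volterra_funpow[OF assms(2,4), of n]
    ell1_seq_volterra_funpow[OF ell1_seq_kron assms(4), of n]
  note A = ell1_mat_outer[OF l1(1) l1(4)] and B = ell1_mat_outer[OF l1(2) l1(3)]
    and C = ell1_mat_outer[OF l1(2) l1(4)]
  note C' = ell1_mat_scale[OF C(1), of "- \<gamma>"]
  note AB = ell1_mat_add[OF A(1) B(1)]
  note ABC = ell1_mat_add[OF AB(1) C'(1)]
  show "ell1_mat (picard_coeff r \<sigma> \<tau> \<alpha> \<beta> \<gamma> n)"
    unfolding picard_coeff_def by (rule ell1_mat_scale[OF ABC(1)])
  show "induced_fun (picard_coeff r \<sigma> \<tau> \<alpha> \<beta> \<gamma> n) (s, t) = picard_fun r \<sigma> \<tau> \<alpha> \<beta> \<gamma> n s t"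
    if st: "s \<in> {0..1}" "t \<in> {0..1}"
    unfolding picard_coeff_def picard_fun_def induced_fun_scale induced_fun_add[OF AB(1) C'(1) st]
      induced_fun_add[OF A(1) B(1) st] induced_fun_outer by simp
  have nonneg: "seq_norm c \<ge> 0" for c
    unfolding seq_norm_def by (rule infsum_nonneg) simp
  note grow = seq_norm_volterra_funpow[OF assms(1,3), of n] seq_norm_volterra_funpow[OF assms(2,4), of n]
  note decay = seq_norm_volterra_funpow_kron[OF assms(3), of n] seq_norm_volterra_funpow_kron[OF assms(4), of n]
  have four: "2 ^ n * (2 ^ n / fact n) = (4 ^ n / fact n :: real)"
    by (simp add: power_mult_distrib[symmetric])
  have a: "seq_norm ?a * seq_norm ?q \<le> seq_norm \<alpha> * (4 ^ n / fact n)"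
    using mult_mono[OF grow(1) decay(2)] nonneg unfolding four[symmetric] by (simp add: ac_simps)
  have b: "seq_norm ?p * seq_norm ?b \<le> seq_norm \<beta> * (4 ^ n / fact n)"
    using mult_mono[OF grow(2) decay(1)] nonneg unfolding four[symmetric] by (simp add: ac_simps)
  have "seq_norm ?p * seq_norm ?q \<le> 2 ^ n * (2 ^ n / fact n)"
  proof (rule mult_mono[OF order_trans[OF decay(1)] decay(2)])
    show "2 ^ n / fact n \<le> (2 ^ n :: real)"
      using fact_ge_1[of n, where 'a = real] by (simp add: field_simps)
  qed (use nonneg in auto)
  then have c: "\<bar>\<gamma>\<bar> * (seq_norm ?p * seq_norm ?q) \<le> \<bar>\<gamma>\<bar> * (4 ^ n / fact n)"
    unfolding four by (intro mult_left_mono) auto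
  have "ell1_norm (picard_coeff r \<sigma> \<tau> \<alpha> \<beta> \<gamma> n) \<le>
      \<bar>r\<bar> ^ n * (seq_norm ?a * seq_norm ?q + seq_norm ?p * seq_norm ?b + \<bar>\<gamma>\<bar> * (seq_norm ?p * seq_norm ?q))"
    unfolding picard_coeff_def ell1_mat_scale(2)[OF ABC(1)] power_abs
    using ABC(2) AB(2) unfolding A(2) B(2) C(2) C'(2)
    by (intro mult_left_mono) auto
  also have "\<dots> \<le> \<bar>r\<bar> ^ n * (seq_norm \<alpha> * (4 ^ n / fact n) + seq_norm \<beta> * (4 ^ n / fact n) + \<bar>\<gamma>\<bar> * (4 ^ n / fact n))"
    by (rule mult_left_mono[OF add_mono[OF add_mono[OF a b] c]]) simp
  also have "\<dots> = (seq_norm \<alpha> + seq_norm \<beta> + \<bar>\<gamma>\<bar>) * ((4 * \<bar>r\<bar>) ^ n / fact n)"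
    by (simp add: power_mult_distrib add_divide_distrib distrib_left distrib_right ac_simps)
  finally show "ell1_norm (picard_coeff r \<sigma> \<tau> \<alpha> \<beta> \<gamma> n)
      \<le> (seq_norm \<alpha> + seq_norm \<beta> + \<bar>\<gamma>\<bar>) * ((4 * \<bar>r\<bar>) ^ n / fact n)" .
qed

lemma exp_terms_summable: "summable (\<lambda>n. (x :: real) ^ n / fact n)"
  using summable_exp[of x] by (simp add: field_simps)

lemma summable_ell1_norm_picard_coeff:
  assumes "ell1_seq \<alpha>" "ell1_seq \<beta>" "\<sigma> \<in> {0..1}" "\<tau> \<in> {0..1}"
  shows "summable (\<lambda>n. ell1_norm (picard_coeff r \<sigma> \<tau> \<alpha> \<beta> \<gamma> n))"
proof (rule summable_comparison_test'[where N = 0])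
  show "summable (\<lambda>n. (seq_norm \<alpha> + seq_norm \<beta> + \<bar>\<gamma>\<bar>) * ((4 * \<bar>r\<bar>) ^ n / fact n))"
    by (intro summable_mult exp_terms_summable)
  show "norm (ell1_norm (picard_coeff r \<sigma> \<tau> \<alpha> \<beta> \<gamma> n))
      \<le> (seq_norm \<alpha> + seq_norm \<beta> + \<bar>\<gamma>\<bar>) * ((4 * \<bar>r\<bar>) ^ n / fact n)" for n
    using ell1_norm_picard_coeff[OF assms] ell1_norm_nonneg by simp
qed

text \<open>
  Any solution of the Goursat problem is the sum of the Picard terms built from its edge data. Each
  remainder has \<open>r\<close> times the previous one as its mixed derivative; from the second on they vanish on
  the left and bottom edges, so the estimate for such functions applies repeatedly, starting from
  the maximum of \<open>|K|\<close>.
\<close>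

lemma goursat_picard_limit:
  fixes K :: "real \<times> real \<Rightarrow> real"
  assumes ab: "0 \<le> a" "a < b" "b \<le> 1" and cd: "0 \<le> c" "c < d" "d \<le> 1"
    and \<alpha>: "ell1_seq \<alpha>" and \<beta>: "ell1_seq \<beta>"
    and cont: "continuous_on ({a..b} \<times> {c..d}) K"
    and bottom: "\<And>s. s \<in> {a..b} \<Longrightarrow> K (s, c) = pairing (eta s) \<alpha>"
    and left: "\<And>t. t \<in> {c..d} \<Longrightarrow> K (a, t) = pairing (eta t) \<beta>"
    and dt: "\<And>s t. s \<in> {a<..<b} \<Longrightarrow> t \<in> {c<..<d} \<Longrightarrow>
      ((\<lambda>t. K (s, t)) has_real_derivative v s t) (at t)"
    and ds: "\<And>s t. s \<in> {a<..<b} \<Longrightarrow> t \<in> {c<..<d} \<Longrightarrow>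
      ((\<lambda>s. v s t) has_real_derivative r * K (s, t)) (at s)"
    and st: "s \<in> {a..b}" "t \<in> {c..d}"
  shows "(\<lambda>m. \<Sum>n<m. picard_fun r a c \<alpha> \<beta> (K (a, c)) n s t) \<longlonglongrightarrow> K (s, t)"
proof -
  define f where "f n s = pairing (eta s) ((volterra a ^^ n) \<alpha>)" for n s
  define p where "p n s = pairing (eta s) ((volterra a ^^ n) (kron 0))" for n s
  define g where "g n t = pairing (eta t) ((volterra c ^^ n) \<beta>)" for n t
  define q where "q n t = pairing (eta t) ((volterra c ^^ n) (kron 0))" for n t
  define \<gamma> where "\<gamma> = K (a, c)"
  define \<kappa> where "\<kappa> n s t = r ^ n * (f n s * q n t + p n s * g n t - \<gamma> * (p n s * q n t))" for n s t
  have \<kappa>: "picard_fun r a c \<alpha> \<beta> (K (a, c)) n s t = \<kappa> n s t" for n s t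
    by (simp add: \<kappa>_def picard_fun_def f_def p_def g_def q_def \<gamma>_def)
  have a01: "a \<in> {0..1}" and c01: "c \<in> {0..1}" using ab cd by auto
  note l1 = ell1_seq_volterra_funpow[OF \<alpha> a01] ell1_seq_volterra_funpow[OF ell1_seq_kron a01]
    ell1_seq_volterra_funpow[OF \<beta> c01] ell1_seq_volterra_funpow[OF ell1_seq_kron c01]
  have D: "(f (Suc n) has_real_derivative f n x) (at x)" "(p (Suc n) has_real_derivative p n x) (at x)"
    "(g (Suc n) has_real_derivative g n x) (at x)" "(q (Suc n) has_real_derivative q n x) (at x)"
    if "x \<in> {0<..<1}" for n x
    using volterra_has_derivative[OF l1(1) a01 that] volterra_has_derivative[OF l1(2) a01 that]
      volterra_has_derivative[OF l1(3) c01 that] volterra_has_derivative[OF l1(4) c01 that]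
    by (simp_all add: f_def[abs_def] p_def[abs_def] g_def[abs_def] q_def[abs_def])
  have Z: "f (Suc n) a = 0" "p (Suc n) a = 0" "g (Suc n) c = 0" "q (Suc n) c = 0" for n
    using volterra_vanishes[OF l1(1) a01] volterra_vanishes[OF l1(2) a01]
      volterra_vanishes[OF l1(3) c01] volterra_vanishes[OF l1(4) c01]
    by (simp_all add: f_def p_def g_def q_def)
  have \<kappa>_edge: "\<kappa> (Suc n) a t = 0" "\<kappa> (Suc n) s c = 0" for n s t
    by (simp_all only: \<kappa>_def Z) simp_all
  have fg_0: "f 0 s = pairing (eta s) \<alpha>" "g 0 t = pairing (eta t) \<beta>" for s t
    by (simp_all add: f_def g_def)
  have one: "p 0 s = 1" "q 0 s = 1" for s
    by (simp_all add: p_def q_def pairing_kron eta_def)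
  have \<kappa>_0: "\<kappa> 0 s t = f 0 s + g 0 t - \<gamma>" for s t
    by (simp add: \<kappa>_def one)
  define g' where "g' t = (\<Sum>i. diffs \<beta> i * t ^ i)" for t
  have g': "(g 0 has_real_derivative g' x) (at x)" if "x \<in> {0<..<1}" for x
    using power_function_differentiable[OF \<beta> that] by (simp add: g_def[abs_def] g'_def)
  \<comment> \<open>\<open>\<mu> n\<close> is the derivative of \<open>\<kappa> (Suc n)\<close> in \<open>t\<close>; its derivative in \<open>s\<close> is \<open>r * \<kappa> n\<close>.\<close>
  define \<mu> where "\<mu> n s t = r ^ Suc n * (f (Suc n) s * q n t + p (Suc n) s * g n t - \<gamma> * (p (Suc n) s * q n t))"
    for n s t
  define u where "u m z = K z - (\<Sum>n<m. \<kappa> n (fst z) (snd z))" for m z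
  have "bounded (K ` ({a..b} \<times> {c..d}))"
    by (intro compact_imp_bounded compact_continuous_image cont compact_Times compact_Icc)
  then obtain B where "\<forall>w \<in> K ` ({a..b} \<times> {c..d}). norm w \<le> B"
    unfolding bounded_iff by (elim exE)
  then have B: "\<bar>K z\<bar> \<le> B" if "z \<in> {a..b} \<times> {c..d}" for z
    using that by auto
  have "B \<ge> 0" using B[of "(s, t)"] st by auto
  have sub: "{a..b} \<subseteq> {0..1}" "{c..d} \<subseteq> {0..1}" using ab cd by auto
  have fst_cont: "continuous_on ({a..b} \<times> {c..d}) (\<lambda>z. h (fst z))"
    and snd_cont: "continuous_on ({a..b} \<times> {c..d}) (\<lambda>z. h (snd z))"
    if "continuous_on {0..1} h" for h :: "real \<Rightarrow> real"
    using sub by (auto intro!: continuous_on_compose2[OF that] continuous_on_fst continuous_on_snd)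
  have ct: "continuous_on ({a..b} \<times> {c..d}) (\<lambda>z. \<kappa> n (fst z) (snd z))" for n
  proof -
    have "continuous_on {0..1} (f n)" "continuous_on {0..1} (p n)"
      "continuous_on {0..1} (g n)" "continuous_on {0..1} (q n)"
      using l1 by (auto simp: f_def[abs_def] p_def[abs_def] g_def[abs_def] q_def[abs_def]
          intro: continuous_on_power_function)
    then show ?thesis
      unfolding \<kappa>_def by (intro continuous_intros fst_cont snd_cont)
  qed
  have bound: "\<bar>u m (s, t)\<bar> \<le> B * \<bar>r\<bar> ^ m / (fact m)\<^sup>2 * (s - a) ^ m * (t - c) ^ m"
    if "s \<in> {a..b}" "t \<in> {c..d}" for m s t
    using that
  proof (induction m arbitrary: s t)
    case 0
    then show ?case using B[of "(s, t)"] by (simp add: u_def)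
  next
    case (Suc m)
    have "\<bar>u (Suc m) (s, t)\<bar> \<le>
        B * \<bar>r\<bar> ^ Suc m / (fact m)\<^sup>2 / (real (Suc m))\<^sup>2 * (s - a) ^ Suc m * (t - c) ^ Suc m"
    proof (rule goursat_bound[OF ab(2) cd(2)])
      show "continuous_on ({a..b} \<times> {c..d}) (u (Suc m))"
        unfolding u_def[abs_def] by (intro continuous_intros cont ct)
      \<comment> \<open>The zeroth Picard term has mixed derivative 0 and interpolates the edge data; all later
      ones vanish on the edges.\<close>
      have split: "u (Suc m) (s, t) = K (s, t) - (f 0 s + g 0 t - \<gamma>) - (\<Sum>n<m. \<kappa> (Suc n) s t)" for s t
        by (simp add: u_def sum.lessThan_Suc_shift \<kappa>_0 del: sum.lessThan_Suc)
      show "u (Suc m) (a, t) = 0" if "t \<in> {c..d}" for t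
        using left[OF that] bottom[of a] ab
        by (simp add: split \<kappa>_edge fg_0 \<gamma>_def)
      show "u (Suc m) (s, c) = 0" if "s \<in> {a..b}" for s
        using bottom[OF that] left[of c] cd
        by (simp add: split \<kappa>_edge fg_0 \<gamma>_def)
      fix s t assume s: "s \<in> {a<..<b}" and t: "t \<in> {c<..<d}"
      have s01: "s \<in> {0<..<1}" and t01: "t \<in> {0<..<1}" using s t ab cd by auto
      have \<kappa>t: "((\<lambda>t. \<kappa> (Suc n) s t) has_real_derivative \<mu> n s t) (at t)" for n
        unfolding \<kappa>_def \<mu>_def
        by (intro DERIV_cmult DERIV_diff DERIV_add D t01)
      have \<mu>s: "((\<lambda>s. \<mu> n s t) has_real_derivative r * \<kappa> n s t) (at s)" for n
      proof -
        have "((\<lambda>s. \<mu> n s t) has_real_derivative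
            r ^ Suc n * (f n s * q n t + p n s * g n t - \<gamma> * (p n s * q n t))) (at s)"
          unfolding \<mu>_def by (intro DERIV_cmult DERIV_diff DERIV_add DERIV_cmult_right D s01)
        then show ?thesis by (simp only: \<kappa>_def power_Suc mult.assoc)
      qed
      show "((\<lambda>t. u (Suc m) (s, t)) has_real_derivative
          v s t - (0 + g' t - 0) - (\<Sum>n<m. \<mu> n s t)) (at t)"
        unfolding split by (intro DERIV_diff DERIV_add DERIV_const DERIV_sum dt s t g' t01 \<kappa>t)
      show "((\<lambda>s. v s t - (0 + g' t - 0) - (\<Sum>n<m. \<mu> n s t)) has_real_derivative
          r * K (s, t) - 0 - (\<Sum>n<m. r * \<kappa> n s t)) (at s)"
        by (intro DERIV_diff DERIV_const DERIV_sum ds s t \<mu>s)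
      have "r * K (s, t) - 0 - (\<Sum>n<m. r * \<kappa> n s t) = r * u m (s, t)"
        by (simp add: u_def sum_distrib_left right_diff_distrib)
      moreover have "\<bar>r\<bar> * \<bar>u m (s, t)\<bar> \<le> \<bar>r\<bar> * (B * \<bar>r\<bar> ^ m / (fact m)\<^sup>2 * (s - a) ^ m * (t - c) ^ m)"
        using Suc.IH[of s t] s t by (intro mult_left_mono) auto
      ultimately show "\<bar>r * K (s, t) - 0 - (\<Sum>n<m. r * \<kappa> n s t)\<bar>
          \<le> B * \<bar>r\<bar> ^ Suc m / (fact m)\<^sup>2 * (s - a) ^ m * (t - c) ^ m"
        by (simp only: abs_mult) (simp add: ac_simps)
    qed (use \<open>B \<ge> 0\<close> Suc.prems in auto)
    then show ?case by (simp add: power_mult_distrib ac_simps del: power_Suc of_nat_Suc)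
  qed
  have "\<bar>u m (s, t)\<bar> \<le> B * (\<bar>r\<bar> ^ m / fact m)" for m
  proof -
    have "(s - a) ^ m * (t - c) ^ m \<le> 1 * 1"
      using st ab cd by (intro mult_mono power_le_one) auto
    then have "B * \<bar>r\<bar> ^ m / (fact m)\<^sup>2 * ((s - a) ^ m * (t - c) ^ m) \<le> B * \<bar>r\<bar> ^ m / (fact m)\<^sup>2 * (1 * 1)"
      using \<open>B \<ge> 0\<close> by (intro mult_left_mono) auto
    also have "\<dots> \<le> B * \<bar>r\<bar> ^ m / fact m"
      using \<open>B \<ge> 0\<close> fact_ge_1[of m, where 'a = real]
      by (auto simp: power2_eq_square intro!: divide_left_mono)
    finally show ?thesis using bound[OF st, of m] by (simp add: mult.assoc)
  qed
  moreover have "(\<lambda>m. B * (\<bar>r\<bar> ^ m / fact m)) \<longlonglongrightarrow> B * 0"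
    by (intro tendsto_intros summable_LIMSEQ_zero exp_terms_summable)
  ultimately have "(\<lambda>m. u m (s, t)) \<longlonglongrightarrow> 0"
    by - (rule Lim_null_comparison[where g = "\<lambda>m. B * (\<bar>r\<bar> ^ m / fact m)"], auto)
  from tendsto_diff[OF tendsto_const[of "K (s, t)"] this] show ?thesis
    by (simp add: u_def \<kappa>)
qed

section \<open>The grid\<close>

lemma grid_between_iff:
  assumes "N \<ge> 2"
  shows "grid N k < s \<longleftrightarrow> real k - 1 < s * (real N - 1)"
    and "s < grid N (k + 1) \<longleftrightarrow> s * (real N - 1) < real k"
  using assms by (simp_all add: grid_def pos_divide_less_eq pos_less_divide_eq)

lemma open_tiles_disjoint:
  assumes "N \<ge> 2" "p \<in> open_tile N k l" "p \<in> open_tile N k' l'"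
  shows "k' = k \<and> l' = l"
proof -
  have "m' = m" if "s \<in> {grid N m<..<grid N (m + 1)}" "s \<in> {grid N m'<..<grid N (m' + 1)}" for s m m'
  proof -
    have "real m - 1 < s * (real N - 1)" "s * (real N - 1) < real m"
      "real m' - 1 < s * (real N - 1)" "s * (real N - 1) < real m'"
      using that grid_between_iff[OF assms(1)] by (simp_all only: greaterThanLessThan_iff)
    then show ?thesis by linarith
  qed
  then show ?thesis using assms(2,3) by (auto simp: open_tile_def)
qed

lemma rho_fun_open_tile:
  assumes "N \<ge> 2" "k \<in> {1..N - 1}" "l \<in> {1..N - 1}" "p \<in> open_tile N k l"
  shows "rho_fun N x y p = rho N x y k l"
proof -
  have ind: "indicator (open_tile N k' l') p = (if k' = k then if l' = l then 1 else 0 else (0 :: real))"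
    for k' l'
    using assms(4) by (auto simp: indicator_def dest: open_tiles_disjoint[OF assms(1,4)])
  have "rho_fun N x y p = (\<Sum>k'=1..N - 1. \<Sum>l'=1..N - 1. if k' = k then if l' = l then rho N x y k l else 0 else 0)"
    unfolding rho_fun_def ind by (intro sum.cong refl) auto
  also have "\<dots> = (\<Sum>k'=1..N - 1. if k' = k then rho N x y k l else 0)"
    using assms(3) by (intro sum.cong refl) (simp add: sum.delta)
  also have "\<dots> = rho N x y k l"
    using assms(2) by (simp add: sum.delta)
  finally show ?thesis .
qed

lemma grid_range:
  assumes "N \<ge> 2" "k \<in> {1..N - 1}"
  shows "0 \<le> grid N k" "grid N k < grid N (k + 1)" "grid N (k + 1) \<le> 1"
  using assms by (auto simp: grid_def divide_strict_right_mono)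

section \<open>The matrices of the tiles\<close>

lemma tile_term_eq_picard_coeff:
  assumes "ell1_seq (tile_alpha N C k l)" "ell1_seq (tile_beta N C k l)"
    and "grid N k \<in> {0..1}" "grid N l \<in> {0..1}"
  shows "tile_term N x y C k l n = picard_coeff (rho N x y k l) (grid N k) (grid N l)
           (tile_alpha N C k l) (tile_beta N C k l) (tile_gamma N C k l) n"
proof (induction n)
  case 0
  show ?case by (auto simp: picard_coeff_def fun_eq_iff kron_def)
next
  case (Suc n)
  then show ?case by (simp add: picard_coeff_Suc[OF assms])
qed

text \<open>
  This lets the matrices be defined recursively although \<open>tile_term\<close> takes a whole family as argument.
\<close>

lemma tile_term_cong:
  assumes "C k (l - 1) = C' k (l - 1)" "C (k - 1) l = C' (k - 1) l"
  shows "tile_term N x y C k l n = tile_term N x y C' k l n"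
proof (induction n)
  case 0
  show ?case by (simp only: tile_term.simps tile_alpha_def tile_beta_def tile_gamma_def assms)
qed simp

text \<open>
  The recursive calls may only concern the two neighbours, so the family handed to \<open>tile_term\<close> is an
  ad hoc one: it agrees with \<open>tile_coeff\<close> at \<open>(k + 1, l)\<close> and \<open>(k, l + 1)\<close>, the two places that matter for
  tile \<open>(k + 1, l + 1)\<close>.
\<close>

fun tile_coeff ::
  "nat \<Rightarrow> (nat \<Rightarrow> real ^ 'd) \<Rightarrow> (nat \<Rightarrow> real ^ 'd) \<Rightarrow> nat \<Rightarrow> nat \<Rightarrow> infmat" where
  "tile_coeff N x y 0 l = (\<lambda>i j. kron 0 i * kron 0 j)"
| "tile_coeff N x y (Suc k) 0 = (\<lambda>i j. kron 0 i * kron 0 j)"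
| "tile_coeff N x y (Suc k) (Suc l) = (\<lambda>i j. \<Sum>n. tile_term N x y
     (\<lambda>k' l'. if k' = Suc k then tile_coeff N x y (Suc k) l else tile_coeff N x y k (Suc l))
     (Suc k) (Suc l) n i j)"

lemma tile_coeff_eq_suminf:
  assumes "k \<ge> 1" "l \<ge> 1"
  shows "tile_coeff N x y k l = (\<lambda>i j. \<Sum>n. tile_term N x y (tile_coeff N x y) k l n i j)"
proof -
  obtain k' l' where kl: "k = Suc k'" "l = Suc l'"
    using assms by (metis Suc_le_D One_nat_def)
  let ?C = "\<lambda>p q. if p = Suc k' then tile_coeff N x y (Suc k') l' else tile_coeff N x y k' (Suc l')"
  have "tile_term N x y ?C k l n = tile_term N x y (tile_coeff N x y) k l n" for n
    by (rule tile_term_cong) (simp_all add: kl)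
  then show ?thesis by (simp add: kl)
qed

definition represents_on_tile ::
  "nat \<Rightarrow> (nat \<Rightarrow> real ^ 'd) \<Rightarrow> (nat \<Rightarrow> real ^ 'd) \<Rightarrow> (nat \<Rightarrow> nat \<Rightarrow> infmat) \<Rightarrow>
    (real \<times> real \<Rightarrow> real) \<Rightarrow> nat \<Rightarrow> nat \<Rightarrow> bool" where
  "represents_on_tile N x y C K k l \<longleftrightarrow>
       ell1_mat (C k l) \<and>
       ell1_seq (tile_alpha N C k l) \<and>
       ell1_seq (tile_beta N C k l) \<and>
       (\<forall>n. ell1_mat (tile_term N x y C k l n)) \<and>
       (\<forall>p\<in>tile N k l. K p = induced_fun (C k l) p) \<and>
       (\<lambda>m. ell1_norm (\<lambda>i j. C k l i j - (\<Sum>n\<le>m. tile_term N x y C k l n i j)))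
         \<longlonglongrightarrow> 0 \<and>
       uniform_limit (tile N k l)
         (\<lambda>m. induced_fun (\<lambda>i j. \<Sum>n\<le>m. tile_term N x y C k l n i j)) K sequentially"

text \<open>
  The data on the bottom and left edges of the tile are read off from the representations on the
  neighbours. Summability of the norms gives convergence in \<open>\<ell>\<^sub>1\<close>, hence uniform convergence of the
  induced functions; the Picard expansion of \<open>K\<close> identifies the limit.
\<close>

lemma represents_on_tile_step:
  fixes x y :: "nat \<Rightarrow> real ^ 'd"
  assumes N: "N \<ge> 2" and K: "is_signature_kernel N x y K"
    and kl: "k \<in> {1..N - 1}" "l \<in> {1..N - 1}"
    and below: "ell1_mat (C k (l - 1))"
      "\<And>s. s \<in> {grid N k..grid N (k + 1)} \<Longrightarrow> K (s, grid N l) = induced_fun (C k (l - 1)) (s, grid N l)"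
    and beside: "ell1_mat (C (k - 1) l)"
      "\<And>t. t \<in> {grid N l..grid N (l + 1)} \<Longrightarrow> K (grid N k, t) = induced_fun (C (k - 1) l) (grid N k, t)"
    and C: "C k l = (\<lambda>i j. \<Sum>n. tile_term N x y C k l n i j)"
  shows "represents_on_tile N x y C K k l"
proof -
  define a b c d where abcd: "a = grid N k" "b = grid N (k + 1)" "c = grid N l" "d = grid N (l + 1)"
  have ab: "0 \<le> a" "a < b" "b \<le> 1" and cd: "0 \<le> c" "c < d" "d \<le> 1"
    using grid_range[OF N kl(1)] grid_range[OF N kl(2)] by (auto simp: abcd)
  then have a01: "a \<in> {0..1}" and c01: "c \<in> {0..1}"
    and sub: "{a..b} \<subseteq> {0..1}" "{c..d} \<subseteq> {0..1}" by auto
  let ?\<alpha> = "tile_alpha N C k l" and ?\<beta> = "tile_beta N C k l" and ?r = "rho N x y k l"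
  let ?T = "tile_term N x y C k l"
  have \<alpha>: "ell1_seq ?\<alpha>"
    unfolding tile_alpha_def using ell1_seq_inf_mult_vec[OF below(1) c01] by (simp add: abcd)
  have \<beta>: "ell1_seq ?\<beta>"
    unfolding tile_beta_def
    using ell1_seq_inf_mult_vec[OF ell1_mat_transpose[OF beside(1)] a01] by (simp add: abcd)
  have bottom: "K (s, c) = pairing (eta s) ?\<alpha>" if "s \<in> {a..b}" for s
    using below(2)[of s] that by (simp add: abcd tile_alpha_def induced_fun_def)
  have left: "K (a, t) = pairing (eta t) ?\<beta>" if "t \<in> {c..d}" for t
    using beside(2)[of t] that induced_fun_transpose[OF beside(1) a01, of t] sub
    by (auto simp: abcd tile_beta_def)
  have \<gamma>: "tile_gamma N C k l = K (a, c)"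
    using beside(2)[of c] cd by (simp add: abcd tile_gamma_def induced_fun_def)
  have T: "?T n = picard_coeff ?r a c ?\<alpha> ?\<beta> (K (a, c)) n" for n
    unfolding \<gamma>[symmetric] unfolding abcd
    by (rule tile_term_eq_picard_coeff[OF \<alpha> \<beta>]) (use a01 c01 in \<open>simp_all only: abcd\<close>)
  note l1 = \<alpha> \<beta> a01 c01
  have mat: "ell1_mat (?T n)" for n
    unfolding T by (rule ell1_mat_picard_coeff[OF l1])
  have summ: "summable (\<lambda>n. ell1_norm (?T n))"
    unfolding T by (rule summable_ell1_norm_picard_coeff[OF l1])
  let ?P = "\<lambda>m i j. \<Sum>n\<le>m. ?T n i j"
  let ?D = "\<lambda>m i j. C k l i j - ?P m i j"
  have matC: "ell1_mat (C k l)" and lim: "(\<lambda>m. ell1_norm (?D m)) \<longlonglongrightarrow> 0"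
    unfolding C by (rule ell1_mat_series[OF mat summ])+
  have P: "?P m = (\<lambda>i j. \<Sum>n<Suc m. ?T n i j)" for m
    by (simp add: lessThan_Suc_atMost)
  have matP: "ell1_mat (?P m)" for m
    unfolding P by (rule ell1_mat_sum) (rule mat)
  have err: "\<bar>induced_fun (C k l) (s, t) - induced_fun (?P m) (s, t)\<bar> \<le> ell1_norm (?D m)"
    if st: "s \<in> {0..1}" "t \<in> {0..1}" for s t m
  proof -
    note neg = ell1_mat_scale(1)[OF matP[of m], of "-1"]
    have D: "ell1_mat (?D m)" using ell1_mat_add(1)[OF matC neg] by simp
    have "induced_fun (?D m) (s, t) = induced_fun (C k l) (s, t) - induced_fun (?P m) (s, t)"
      using induced_fun_add[OF matC neg st] induced_fun_scale[of "-1" "?P m" "(s, t)"] by simp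
    with abs_induced_fun_le[OF D st] show ?thesis by (simp only:)
  qed
  have dt: "((\<lambda>t. K (s, t)) has_real_derivative deriv (\<lambda>t. K (s, t)) t) (at t)"
    and ds: "((\<lambda>s. deriv (\<lambda>t. K (s, t)) t) has_real_derivative ?r * K (s, t)) (at s)"
    if "s \<in> {a<..<b}" "t \<in> {c<..<d}" for s t
  proof -
    have o: "(s, t) \<in> open_tile N k l" using that by (simp add: open_tile_def abcd)
    then have "(s, t) \<in> tile_interior N" using kl unfolding tile_interior_def by blast
    with K have *: "(\<lambda>t. K (s, t)) differentiable (at t)"
      "((\<lambda>s. deriv (\<lambda>t. K (s, t)) t) has_real_derivative rho_fun N x y (s, t) * K (s, t)) (at s)"
      by (auto simp: is_signature_kernel_def)
    show "((\<lambda>t. K (s, t)) has_real_derivative deriv (\<lambda>t. K (s, t)) t) (at t)"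
      using *(1) by (simp add: DERIV_deriv_iff_real_differentiable)
    show "((\<lambda>s. deriv (\<lambda>t. K (s, t)) t) has_real_derivative ?r * K (s, t)) (at s)"
      using *(2) by (simp only: rho_fun_open_tile[OF N kl o])
  qed
  have cont: "continuous_on ({a..b} \<times> {c..d}) K"
    using K sub by (auto simp: is_signature_kernel_def intro: continuous_on_subset)
  have tile: "tile N k l = {a..b} \<times> {c..d}" by (simp add: tile_def abcd)
  have eq: "K p = induced_fun (C k l) p" if p: "p \<in> tile N k l" for p
  proof -
    obtain s t where st: "p = (s, t)" "s \<in> {a..b}" "t \<in> {c..d}" using p tile by auto
    then have st01: "s \<in> {0..1}" "t \<in> {0..1}" using sub by auto
    have "induced_fun (?P m) (s, t) = (\<Sum>n<Suc m. picard_fun ?r a c ?\<alpha> ?\<beta> (K (a, c)) n s t)" for m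
      unfolding P induced_fun_sum[OF mat st01] unfolding T by (simp only: induced_fun_picard_coeff[OF l1 st01])
    then have to_K: "(\<lambda>m. induced_fun (?P m) (s, t)) \<longlonglongrightarrow> K (s, t)"
      using LIMSEQ_Suc[OF goursat_picard_limit[OF ab cd \<alpha> \<beta> cont bottom left dt ds st(2,3)]]
      by (simp only:)
    have "(\<lambda>m. induced_fun (C k l) (s, t) - induced_fun (?P m) (s, t)) \<longlonglongrightarrow> 0"
      by (rule Lim_null_comparison[OF _ lim]) (simp only: real_norm_def err[OF st01] always_eventually simp_thms)
    from tendsto_diff[OF tendsto_const[of "induced_fun (C k l) (s, t)"] this]
    have "(\<lambda>m. induced_fun (?P m) (s, t)) \<longlonglongrightarrow> induced_fun (C k l) (s, t)" by simp
    with to_K show ?thesis unfolding st(1) by (rule LIMSEQ_unique)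
  qed
  have unif: "uniform_limit (tile N k l) (\<lambda>m. induced_fun (?P m)) K sequentially"
  proof (rule uniform_limitI)
    fix e :: real assume "e > 0"
    with lim have "\<forall>\<^sub>F m in sequentially. ell1_norm (?D m) < e"
      by (rule order_tendstoD)
    then show "\<forall>\<^sub>F m in sequentially. \<forall>p\<in>tile N k l. dist (induced_fun (?P m) p) (K p) < e"
    proof eventually_elim
      case (elim m)
      show ?case
      proof
        fix p assume p: "p \<in> tile N k l"
        then obtain s t where st: "p = (s, t)" "s \<in> {0..1}" "t \<in> {0..1}" using tile sub by auto
        show "dist (induced_fun (?P m) p) (K p) < e"
          using err[OF st(2,3), of m] elim eq[OF p] st(1) by (simp add: dist_real_def abs_minus_commute)
      qed
    qed
  qed
  show ?thesis
    unfolding represents_on_tile_def by (intro conjI allI ballI matC \<alpha> \<beta> mat eq lim unif)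
qed

text \<open>
  Induction on \<open>k + l\<close>. A neighbour is either a tile treated before, sharing the relevant edge, or it
  has index 0; then the edge lies on the boundary of the unit square, where both \<open>K\<close> and the function
  induced by the boundary matrix are 1.
\<close>

lemma represents_on_tiles:
  fixes x y :: "nat \<Rightarrow> real ^ 'd"
  assumes N: "N \<ge> 2" and K: "is_signature_kernel N x y K"
    and kl: "k \<in> {1..N - 1}" "l \<in> {1..N - 1}"
  shows "represents_on_tile N x y (tile_coeff N x y) K k l"
  using kl
proof (induction "k + l" arbitrary: k l rule: less_induct)
  case less
  let ?C = "tile_coeff N x y"
  have unit: "ell1_mat (\<lambda>i j. kron 0 i * kron 0 j)"
    "induced_fun (\<lambda>i j. kron 0 i * kron 0 j) (s, t) = 1" for s t
    using ell1_mat_outer(1)[OF ell1_seq_kron ell1_seq_kron]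
    by (simp_all add: induced_fun_outer pairing_kron eta_def)
  have edge: "?C 0 l = (\<lambda>i j. kron 0 i * kron 0 j)" "?C k 0 = (\<lambda>i j. kron 0 i * kron 0 j)" for k l
    by (simp, cases k, simp_all)
  have grid1: "grid N (Suc 0) = 0" by (simp add: grid_def)
  note K' = K[unfolded is_signature_kernel_def]
  have sub: "{grid N m..grid N (m + 1)} \<subseteq> {0..1}" if "m \<in> {1..N - 1}" for m
    using grid_range[OF N that] by auto
  have below: "ell1_mat (?C k (l - 1)) \<and>
      (\<forall>s\<in>{grid N k..grid N (k + 1)}. K (s, grid N l) = induced_fun (?C k (l - 1)) (s, grid N l))"
  proof (cases "l = 1")
    case True
    then show ?thesis using K' sub[OF less.prems(1)] by (auto simp: edge unit grid1)
  next
    case False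
    then have l: "l - 1 \<in> {1..N - 1}" using less.prems(2) by auto
    have "represents_on_tile N x y ?C K k (l - 1)"
      by (rule less.hyps) (use less.prems(1) l in auto)
    moreover have "(s, grid N l) \<in> tile N k (l - 1)" if "s \<in> {grid N k..grid N (k + 1)}" for s
      using that grid_range(2)[OF N l] l by (auto simp: tile_def)
    ultimately show ?thesis by (auto simp: represents_on_tile_def)
  qed
  have beside: "ell1_mat (?C (k - 1) l) \<and>
      (\<forall>t\<in>{grid N l..grid N (l + 1)}. K (grid N k, t) = induced_fun (?C (k - 1) l) (grid N k, t))"
  proof (cases "k = 1")
    case True
    then show ?thesis using K' sub[OF less.prems(2)] by (auto simp: edge unit grid1)
  next
    case False
    then have k: "k - 1 \<in> {1..N - 1}" using less.prems(1) by auto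
    have "represents_on_tile N x y ?C K (k - 1) l"
      by (rule less.hyps) (use less.prems k in auto)
    moreover have "(grid N k, t) \<in> tile N (k - 1) l" if "t \<in> {grid N l..grid N (l + 1)}" for t
      using that grid_range(2)[OF N k] k by (auto simp: tile_def)
    ultimately show ?thesis by (auto simp: represents_on_tile_def)
  qed
  show ?case
  proof (rule represents_on_tile_step[OF N K less.prems])
    show "?C k l = (\<lambda>i j. \<Sum>n. tile_term N x y ?C k l n i j)"
      using less.prems by (intro tile_coeff_eq_suminf) auto
  qed (use below beside in blast)+
qed

theorem proposition2p7:
  fixes x y :: "nat \<Rightarrow> real ^ 'd" and N :: nat and K :: "real \<times> real \<Rightarrow> real"
  assumes "N \<ge> 2"
    and "is_signature_kernel N x y K"
  shows "\<exists>C :: nat \<Rightarrow> nat \<Rightarrow> infmat.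
    (\<forall>\<iota>. C 0 \<iota> = (\<lambda>i j. kron 0 i * kron 0 j) \<and> C \<iota> 0 = (\<lambda>i j. kron 0 i * kron 0 j)) \<and>
    (\<forall>k\<in>{1..N - 1}. \<forall>l\<in>{1..N - 1}.
       ell1_mat (C k l) \<and>
       ell1_seq (tile_alpha N C k l) \<and>
       ell1_seq (tile_beta N C k l) \<and>
       (\<forall>n. ell1_mat (tile_term N x y C k l n)) \<and>
       (\<forall>p\<in>tile N k l. K p = induced_fun (C k l) p) \<and>
       (\<lambda>m. ell1_norm (\<lambda>i j. C k l i j - (\<Sum>n\<le>m. tile_term N x y C k l n i j)))
         \<longlonglongrightarrow> 0 \<and>
       uniform_limit (tile N k l)
         (\<lambda>m. induced_fun (\<lambda>i j. \<Sum>n\<le>m. tile_term N x y C k l n i j)) K sequentially)"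
proof (rule exI[where x = "tile_coeff N x y"], intro conjI allI ballI)
  show "tile_coeff N x y 0 \<iota> = (\<lambda>i j. kron 0 i * kron 0 j)" for \<iota>
    by simp
  show "tile_coeff N x y \<iota> 0 = (\<lambda>i j. kron 0 i * kron 0 j)" for \<iota>
    by (cases \<iota>) simp_all
qed (use represents_on_tiles[OF assms] in \<open>simp_all only: represents_on_tile_def\<close>)

end
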